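(* Let $k\geq 1$ and $\delta\geq 2k$ be integers and let $F(k,\delta)=\max\{8\delta-10k+4,\ \delta(\delta-2k)^2+\delta-1\}$. Suppose that $G$ is a connected graph of even order $n\geq F(k,\delta)$ with minimum degree $\delta$. If $$\rho(G)\geq\rho\bigl(K_{\delta}\nabla(K_{n-2\delta+2k-1}\cup(\delta-2k+1)K_1)\bigr),$$ then $G$ is $k$-extendable, unless $G\cong K_{\delta}\nabla(K_{n-2\delta+2k-1}\cup(\delta-2k+1)K_1)$.
   Context: All graphs are finite, simple and undirected. For a graph $G$, $\rho(G)$ denotes the spectral radius of $G$, i.e. the largest eigenvalue of its adjacency matrix. $K_m$ is the complete graph on $m$ vertices. $G_1\cup G_2$ denotes the disjoint union of graphs, $tH$ denotes the disjoint union of $t$ copies of $H$, and $G_1\nabla G_2$ denotes the join, obtained from $G_1\cup G_2$ by adding all edges between $V(G_1)$ and $V(G_2)$. A connected graph $G$ is $k$-extendable if $G$ contains a matching of size $k$ and every matching of size $k$ in $G$ is contained in a perfect matching of $G$. *)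

theory Defs
  imports Complex_Main "Jordan_Normal_Form.Char_Poly"
begin

text \<open>Undirected edges are represented as two-element sets of vertices.\<close>

record 'a ugraph =
  vertices :: "'a set"
  edges :: "'a set set"

definition simple_graph :: "'a ugraph \<Rightarrow> bool" where
  "simple_graph G \<longleftrightarrow>
     finite (vertices G) \<and> (\<forall>e\<in>edges G. e \<subseteq> vertices G \<and> card e = 2)"

definition graph_connected :: "'a ugraph \<Rightarrow> bool" where
  "graph_connected G \<longleftrightarrow>
     vertices G \<noteq> {} \<and>
     (\<forall>u\<in>vertices G. \<forall>v\<in>vertices G. (u, v) \<in> {(x, y). {x, y} \<in> edges G}\<^sup>*)"

definition graph_order :: "'a ugraph \<Rightarrow> nat" where
  "graph_order G = card (vertices G)"

definition graph_degree :: "'a ugraph \<Rightarrow> 'a \<Rightarrow> nat" where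
  "graph_degree G v = card {e \<in> edges G. v \<in> e}"

definition min_degree :: "'a ugraph \<Rightarrow> nat" where
  "min_degree G = Min (graph_degree G ` vertices G)"

definition graph_iso :: "'a ugraph \<Rightarrow> 'b ugraph \<Rightarrow> bool" where
  "graph_iso G H \<longleftrightarrow>
     (\<exists>f. bij_betw f (vertices G) (vertices H) \<and>
          (\<forall>u\<in>vertices G. \<forall>v\<in>vertices G. {u, v} \<in> edges G \<longleftrightarrow> {f u, f v} \<in> edges H))"

text \<open>
  The adjacency matrix is taken with respect to an arbitrary enumeration of the vertices;
  another enumeration conjugates it by a permutation matrix, so the eigenvalues
  do not depend on the choice.
\<close>

definition vertex_enum :: "'a ugraph \<Rightarrow> nat \<Rightarrow> 'a" where
  "vertex_enum G = (SOME f. bij_betw f {0..<graph_order G} (vertices G))"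

definition adjacency_matrix :: "'a ugraph \<Rightarrow> real mat" where
  "adjacency_matrix G =
     mat (graph_order G) (graph_order G)
       (\<lambda>(i, j). if {vertex_enum G i, vertex_enum G j} \<in> edges G then 1 else 0)"

text \<open>
  The adjacency matrix is real symmetric, so all its eigenvalues are real and, for a
  graph with at least one vertex, the set below is finite and nonempty.
\<close>

definition graph_spectral_radius :: "'a ugraph \<Rightarrow> real" where
  "graph_spectral_radius G = Max {x. eigenvalue (adjacency_matrix G) x}"

definition complete_graph :: "nat \<Rightarrow> nat ugraph" where
  "complete_graph m =
     \<lparr>vertices = {0..<m}, edges = {{u, v} |u v. u < m \<and> v < m \<and> u \<noteq> v}\<rparr>"

definition disjoint_union :: "'a ugraph \<Rightarrow> 'b ugraph \<Rightarrow> ('a + 'b) ugraph" where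
  "disjoint_union G H =
     \<lparr>vertices = Inl ` vertices G \<union> Inr ` vertices H,
      edges = (\<lambda>e. Inl ` e) ` edges G \<union> (\<lambda>e. Inr ` e) ` edges H\<rparr>"

definition graph_copies :: "nat \<Rightarrow> 'a ugraph \<Rightarrow> (nat \<times> 'a) ugraph" where
  "graph_copies t H =
     \<lparr>vertices = {0..<t} \<times> vertices H,
      edges = (\<Union>i\<in>{0..<t}. (\<lambda>e. Pair i ` e) ` edges H)\<rparr>"

definition graph_join :: "'a ugraph \<Rightarrow> 'b ugraph \<Rightarrow> ('a + 'b) ugraph" where
  "graph_join G H =
     \<lparr>vertices = vertices (disjoint_union G H),
      edges = edges (disjoint_union G H) \<union>
              {{Inl u, Inr v} |u v. u \<in> vertices G \<and> v \<in> vertices H}\<rparr>"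

definition matching :: "'a ugraph \<Rightarrow> 'a set set \<Rightarrow> bool" where
  "matching G M \<longleftrightarrow> M \<subseteq> edges G \<and> (\<forall>e\<in>M. \<forall>f\<in>M. e \<noteq> f \<longrightarrow> e \<inter> f = {})"

definition perfect_matching :: "'a ugraph \<Rightarrow> 'a set set \<Rightarrow> bool" where
  "perfect_matching G M \<longleftrightarrow> matching G M \<and> \<Union>M = vertices G"

definition k_extendable :: "nat \<Rightarrow> 'a ugraph \<Rightarrow> bool" where
  "k_extendable k G \<longleftrightarrow>
     graph_connected G \<and>
     (\<exists>M. matching G M \<and> card M = k) \<and>
     (\<forall>M. matching G M \<and> card M = k \<longrightarrow> (\<exists>P. perfect_matching G P \<and> M \<subseteq> P))"

text \<open>Integer-valued, so that the subtractions are not truncated.\<close>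

definition order_bound :: "nat \<Rightarrow> nat \<Rightarrow> int" where
  "order_bound k d =
     max (8 * int d - 10 * int k + 4) (int d * (int d - 2 * int k)\<^sup>2 + int d - 1)"

text \<open>
  The graph \<open>K\<^sub>d \<nabla> (K\<^sub>m \<union> (d - 2k + 1) K\<^sub>1)\<close> with \<open>m = n - 2d + 2k - 1\<close>. The natural-number
  subtractions are exact whenever \<open>2k \<le> d\<close> and \<open>order_bound k d \<le> n\<close>.
\<close>

definition extremal_graph :: "nat \<Rightarrow> nat \<Rightarrow> nat \<Rightarrow> (nat + (nat + nat \<times> nat)) ugraph" where
  "extremal_graph k d n =
     graph_join (complete_graph d)
       (disjoint_union (complete_graph (n + 2 * k - (2 * d + 1)))
         (graph_copies (d - 2 * k + 1) (complete_graph 1)))"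

end

theory Submission
  imports Defs "Jordan_Normal_Form.Spectral_Radius"
begin

text \<open>
  Write \<open>t = \<delta> - 2k\<close>. If a \<open>k\<close>-matching does not extend to a perfect matching, Tutte's theorem for the
  graph without its endpoints yields a set \<open>S\<close> with \<open>s = 2k + a\<close> vertices whose removal leaves at least
  \<open>a + 2\<close> parts with no edges in between (their parity plays no role). Let \<open>\<theta>\<close> be
  the eigenvalue of the extremal graph with a positive eigenvector, and give the vertices of \<open>S\<close> the
  weight 1 and those in a part of size \<open>x\<close> the weight \<open>s / (\<theta> + 1 - x)\<close>. The adjacency operator does not increase this positive vector beyond the factor
  \<open>\<theta>\<close> at the vertices outside \<open>S\<close>. At a vertex of \<open>S\<close> its value is at most
  \<open>s - 1 + s \<Sum> x / (\<theta> + 1 - x)\<close>, which by convexity is largest when all parts but one have the least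
  possible size (\<open>1\<close> if \<open>a \<ge> t\<close>, and \<open>t - a + 1\<close> otherwise because of the minimum degree). This
  maximum is less than \<open>\<theta>\<close> if \<open>a \<noteq> t\<close> and equals \<open>\<theta>\<close> if \<open>a = t\<close>. Hence \<open>\<rho>(G) < \<theta>\<close> unless equality
  holds everywhere, which forces \<open>G\<close> to be the extremal graph.
\<close>

subsection \<open>Perfect matchings and separators\<close>

text \<open>A perfect matching is encoded by its partner map, so that matchings can be spliced by a
  case distinction on vertices. For an irreflexive \<open>E\<close> the map has no fixed point in
  \<open>V\<close>.\<close>

definition pm_involution :: "'a set \<Rightarrow> ('a \<Rightarrow> 'a \<Rightarrow> bool) \<Rightarrow> ('a \<Rightarrow> 'a) \<Rightarrow> bool" where
  "pm_involution V E f \<longleftrightarrow> (\<forall>v\<in>V. f v \<in> V \<and> f (f v) = v \<and> E v (f v))"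

lemma pm_involution_insert_pair:
  assumes pm: "pm_involution (V - {u, v}) E f" and uv: "u \<in> V" "v \<in> V" "u \<noteq> v" "E u v" "E v u"
  shows "pm_involution V E (f(u := v, v := u))"
  using assms unfolding pm_involution_def by (auto simp: fun_upd_def)

text \<open>Match two vertices of one color while there are such; once all colors differ, match a
  vertex outside \<open>S\<close> with one in \<open>S\<close>; finally pair up what remains of
  \<open>S\<close>. Each removal keeps the number of colors at most \<open>card S + 1\<close> for
  the remaining \<open>S\<close>.\<close>

lemma pm_involution_of_few_cliques:
  assumes "finite V" "S \<subseteq> V" "even (card V)" "card (color ` (V - S)) \<le> card S + 1"
    and "\<And>u v. u \<in> S \<Longrightarrow> v \<in> V \<Longrightarrow> u \<noteq> v \<Longrightarrow> E u v \<and> E v u"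
    and "\<And>u v. u \<in> V - S \<Longrightarrow> v \<in> V - S \<Longrightarrow> u \<noteq> v \<Longrightarrow> color u = color v \<Longrightarrow> E u v"
  shows "\<exists>f. pm_involution V E f"
  using assms
proof (induction "card V" arbitrary: V S rule: less_induct)
  case less
  have finS: "finite S" using less.prems finite_subset by blast
  consider "V = {}" | u v where "u \<in> V - S" "v \<in> V - S" "u \<noteq> v" "color u = color v"
    | u where "V \<noteq> {}" "u \<in> V - S" "inj_on color (V - S)" | "V \<noteq> {}" "V = S"
    unfolding inj_on_def using less.prems(2) by blast
  then show ?case
  proof cases
    case 1
    then have "pm_involution V E id" by (simp add: pm_involution_def)
    then show ?thesis by blast
  next
    case 2
    let ?V = "V - {u, v}"
    have c: "card ?V = card V - 2" "card V \<ge> 2"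
      using 2 less.prems(1) card_mono[of V "{u,v}"] by (auto simp: card_Diff_subset)
    have "card (color ` (?V - S)) \<le> card (color ` (V - S))"
      using less.prems(1) by (intro card_mono) auto
    then have "\<exists>f. pm_involution ?V E f"
      using less.prems c 2 by (intro less.hyps[of ?V S]) auto
    then show ?thesis using pm_involution_insert_pair 2 less.prems(6) by (metis DiffD1)
  next
    case 3
    have cV: "card V = card S + card (V - S)"
      using less.prems finS by (simp add: card_Diff_subset card_mono)
    have "card (color ` (V - S)) = card (V - S)" using 3 by (simp add: card_image)
    \<comment> \<open>Equality would make \<open>card V\<close> the odd number
      \<open>2 * card S + 1\<close>.\<close>
    then have "card (V - S) \<noteq> card S + 1" "card (V - S) \<le> card S + 1" using cV less.prems by auto
    then have le: "card (V - S) \<le> card S" by simp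
    have "card (V - S) > 0" using 3 less.prems(1) by (auto simp: card_gt_0_iff)
    then obtain s where s: "s \<in> S" using le by fastforce
    let ?V = "V - {s, u}"
    have su: "s \<noteq> u" "s \<in> V" "u \<in> V" using s 3 less.prems by auto
    have c: "card ?V = card V - 2" "card V \<ge> 2"
      using su less.prems(1) card_mono[of V "{s,u}"] by (auto simp: card_Diff_subset)
    have eq: "?V - (S - {s}) = (V - S) - {u}" using s 3 by auto
    have "card (color ` ((V - S) - {u})) \<le> card ((V - S) - {u})"
      using less.prems(1) by (intro card_image_le) auto
    also have "card ((V - S) - {u}) = card (V - S) - 1" using 3 less.prems(1) by simp
    also have "\<dots> \<le> card (S - {s}) + 1" using le s finS by simp
    finally have "card (color ` (?V - (S - {s}))) \<le> card (S - {s}) + 1" unfolding eq .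
    then have "\<exists>f. pm_involution ?V E f"
      using less.prems c su 3 by (intro less.hyps[of ?V "S - {s}"]) auto
    then show ?thesis using pm_involution_insert_pair less.prems(5) s su by metis
  next
    case 4
    have "card V \<noteq> 0" "card V \<noteq> 1" using 4 less.prems by auto
    then have "\<not> card V \<le> Suc 0" by simp
    then obtain u v where uv: "u \<in> V" "v \<in> V" "u \<noteq> v"
      using card_le_Suc0_iff_eq[OF less.prems(1)] by blast
    let ?V = "V - {u, v}"
    have c: "card ?V = card V - 2" "card V \<ge> 2"
      using uv less.prems(1) card_mono[of V "{u,v}"] by (auto simp: card_Diff_subset)
    have "\<exists>f. pm_involution ?V E f"
      using less.prems c 4 by (intro less.hyps[of ?V ?V]) auto
    then show ?thesis using pm_involution_insert_pair less.prems(5) uv 4 by metis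
  qed
qed

text \<open>Here \<open>f\<close> and \<open>g\<close> are perfect matchings after adding the edge \<open>xz\<close>, respectively \<open>yw\<close>. Follow their
  alternating cycle from \<open>w\<close>: if it avoids \<open>xz\<close>, switch along it, and otherwise cut it short by the edge
  from the first of \<open>x\<close>, \<open>z\<close> on it to \<open>y\<close>.\<close>

lemma pm_involution_alternating_path:
  assumes fin: "finite V"
    and pmf: "\<And>v. v \<in> V \<Longrightarrow> f v \<in> V \<and> f (f v) = v \<and> f v \<noteq> v"
    and pmg: "\<And>v. v \<in> V \<Longrightarrow> g v \<in> V \<and> g (g v) = v \<and> g v \<noteq> v"
    and Ef: "\<And>v. v \<in> V \<Longrightarrow> v \<notin> {x, z} \<Longrightarrow> E v (f v)"
    and Eg: "\<And>v. v \<in> V \<Longrightarrow> v \<notin> {y, w} \<Longrightarrow> E v (g v)"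
    and fg: "f x = z" "f z = x" "g y = w" "g w = y"
    and V: "x \<in> V" "y \<in> V" "z \<in> V" "w \<in> V"
    and ne: "w \<notin> {x, z}" "y \<notin> {x, z}"
    and E: "E x y" "E y x" "E y z" "E z y"
  shows "\<exists>f'. pm_involution V E f'"
proof -
  \<comment> \<open>\<open>p\<close> runs through every second vertex of the cycle, following an
    edge of \<open>f\<close> and then one of \<open>g\<close>. The vertices passed in between are
    the \<open>f (p i)\<close>.\<close>
  define h where "h = (\<lambda>v. g (f v))"
  define p where "p i = (h ^^ i) w" for i
  have hV: "(h ^^ i) v \<in> V" if "v \<in> V" for i v
    using that pmf pmg by (induction i) (auto simp: h_def)
  have pV: "p i \<in> V" for i using hV V by (simp add: p_def)
  have pS: "p (Suc i) = g (f (p i))" for i by (simp add: p_def h_def)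
  have p0: "p 0 = w" by (simp add: p_def)
  have injh: "a = b" if "h a = h b" "a \<in> V" "b \<in> V" for a b
    using that pmf pmg unfolding h_def by metis
  \<comment> \<open>An alternating walk that begins and ends with an edge of \<open>f\<close> cannot
    close up: it would fold onto itself, so dropping two edges at both ends leaves a shorter closed
    walk, until \<open>f\<close> or \<open>g\<close> fixes a vertex.\<close>
  have odd_ne: "f ((h ^^ l) u) \<noteq> u" if "u \<in> V" for l u
    using that
  proof (induction l arbitrary: u rule: induct_nat_012)
    case 0 then show ?case using pmf by simp
  next
    case 1 then show ?case using pmf pmg by (simp add: h_def) metis
  next
    case (ge2 l)
    have hu: "h u \<in> V" using ge2.prems hV[of u 1] by simp
    have in1: "(h ^^ l) (h u) \<in> V" using hV hu by blast
    have eq: "(h ^^ Suc (Suc l)) u = h ((h ^^ l) (h u))" by (simp add: funpow_swap1)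
    show ?case
    proof
      assume "f ((h ^^ Suc (Suc l)) u) = u"
      then have "f (g (f ((h ^^ l) (h u)))) = u" unfolding eq by (simp add: h_def)
      then have "g (f ((h ^^ l) (h u))) = f u" using pmf pmg in1 by metis
      then have "g (g (f ((h ^^ l) (h u)))) = h u" by (simp add: h_def)
      then have "f ((h ^^ l) (h u)) = h u" using pmf pmg in1 by simp
      then show False using ge2.IH(1) hu by blast
    qed
  qed
  have per: "\<exists>N. p (Suc N) = w"
  proof -
    have "\<not> inj_on p UNIV"
      using fin pV by (meson finite_subset image_subsetI infinite_UNIV_nat finite_imageD)
    then obtain i j where ij: "i < j" "p i = p j"
      unfolding inj_on_def by (metis linorder_neqE_nat)
    have "p 0 = p (j - i)" using ij
    proof (induction i arbitrary: j)
      case 0 then show ?case by simp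
    next
      case (Suc i)
      then obtain j' where j': "j = Suc j'" by (cases j) auto
      have "p i = p j'" using Suc.prems j' injh[of "p i" "p j'"] pV by (simp add: pS h_def)
      then show ?case using Suc.IH[of j'] Suc.prems j' by simp
    qed
    then show ?thesis using ij by (metis Suc_diff_Suc p_def funpow_0)
  qed
  have fx: "f v \<in> {x, z} \<longleftrightarrow> v \<in> {x, z}" if "v \<in> V" for v
    using pmf[OF that] fg by (metis insertE insertI1 insert_commute singletonD)
  show ?thesis
  proof (cases "\<exists>j. p j \<in> {x, z}")
    case False
    \<comment> \<open>Using \<open>f\<close> on the cycle \<open>C\<close> and \<open>g\<close> off
      it avoids both added edges: \<open>x\<close> and \<open>z\<close> lie outside
      \<open>C\<close>, while \<open>y\<close> and \<open>w\<close> lie inside.\<close>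
    define C where "C = range p \<union> f ` range p"
    have CV: "C \<subseteq> V" using pV pmf by (auto simp: C_def)
    have fC: "f v \<in> C" if "v \<in> C" for v using that pmf pV by (auto simp: C_def)
    have gC: "g v \<in> C" if vC: "v \<in> C" for v
    proof -
      have "(\<exists>i. v = f (p i)) \<or> (\<exists>i. v = p i)" using vC unfolding C_def by blast
      then consider i where "v = f (p i)" | "v = w" | i where "v = p (Suc i)"
        using p0 by (metis not0_implies_Suc)
      then show ?thesis
      proof cases
        case 1
        then have "g v = p (Suc i)" by (simp add: pS)
        then show ?thesis unfolding C_def by blast
      next
        case 2
        obtain N where "p (Suc N) = w" using per by blast
        then have "g w = f (p N)" using pmg pmf pV by (metis pS)
        then show ?thesis using 2 unfolding C_def by blast
      next
        case 3
        then have "g v = f (p i)" using pmg pmf pV by (metis pS)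
        then show ?thesis unfolding C_def by blast
      qed
    qed
    have wC: "w \<in> C" unfolding C_def by (metis UnI1 p0 rangeI)
    then have yC: "y \<in> C" using gC fg by metis
    have xC: "x \<notin> C" "z \<notin> C"
      using False fx pV unfolding C_def by (auto; metis)+
    have gnC: "g v \<notin> C" if "v \<in> V - C" for v using that gC pmg by (metis DiffD1 DiffD2)
    have EC: "E v (f v)" if "v \<in> C" for v using that Ef[of v] xC CV by blast
    have EnC: "E v (g v)" if "v \<in> V - C" for v using that Eg[of v] yC wC by blast
    have "pm_involution V E (\<lambda>v. if v \<in> C then f v else g v)"
      unfolding pm_involution_def using fC gnC pmf pmg EC EnC CV by auto
    then show ?thesis by blast
  next
    case True
    define j where "j = (LEAST j. p j \<in> {x, z})"
    have pj: "p j \<in> {x, z}" using True unfolding j_def by (metis (mono_tags, lifting) LeastI_ex)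
    have least: "p i \<notin> {x, z}" if "i < j" for i using that not_less_Least unfolding j_def by blast
    have j0: "j > 0" using pj ne by (cases j) (auto simp: p_def)
    define P where "P = p ` {..<j} \<union> f ` p ` {..<j}"
    have fP: "f v \<in> P" if "v \<in> P" for v using that pmf pV by (auto simp: P_def)
    have xP: "v \<notin> {x, z}" if "v \<in> P" for v
      using that least fx pV unfolding P_def by blast
    \<comment> \<open>If \<open>y\<close> were some \<open>f (p i)\<close>, the cycle would return
      to \<open>w\<close> by step \<open>j\<close>, so \<open>p j\<close> would occur earlier,
      against minimality; if \<open>y\<close> were some \<open>p i\<close>, then
      \<open>odd_ne\<close> would fail.\<close>
    have yP: "y \<notin> P"
    proof
      assume "y \<in> P"
      then consider i where "i < j" "y = f (p i)" | i where "i < j" "y = p i"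
        unfolding P_def by blast
      then show False
      proof cases
        case 1
        then have "p (Suc i) = w" using fg by (simp add: pS)
        then have "p j = p (j - Suc i)" using 1
          by (metis Suc_leI add_diff_inverse_nat not_less funpow_add comp_apply p_def add.commute)
        then show False using least[of "j - Suc i"] pj 1 by simp
      next
        case 2
        have "i \<noteq> 0" using 2 pmg fg V by (metis p_def funpow_0)
        then obtain l where l: "i = Suc l" by (cases i) auto
        have "f (p l) = w" using 2 l fg pmg pmf pV by (metis pS)
        then show False using odd_ne V(4) unfolding p_def by blast
      qed
    qed
    have wP: "w \<in> P" unfolding P_def using j0 p0 by (metis UnI1 image_eqI lessThan_iff)
    have jP: "p j \<notin> P" using xP pj by blast
    have yj: "y \<noteq> p j" using pj ne by auto
    have pjV: "p j \<in> V" by (rule pV)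
    \<comment> \<open>\<open>g\<close> preserves \<open>?Q\<close>: it pairs \<open>f (p i)\<close>
      with \<open>p (Suc i)\<close>, and \<open>w\<close> with \<open>y\<close>. Hence
      \<open>f\<close> on \<open>P\<close>, the edge between \<open>p j\<close> and
      \<open>y\<close>, and \<open>g\<close> outside \<open>?Q\<close> fit together.\<close>
    let ?Q = "P \<union> {p j, y}"
    have gQ: "g v \<in> ?Q" if "v \<in> ?Q" for v
    proof -
      have "(\<exists>i<j. v = f (p i)) \<or> (\<exists>i\<le>j. v = p i) \<or> v = y"
        using that unfolding P_def by (auto intro: less_imp_le)
      then consider i where "i < j" "v = f (p i)" | "v = w" | i where "i < j" "v = p (Suc i)" | "v = y"
        using p0 by (metis Suc_le_eq not0_implies_Suc)
      then show ?thesis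
      proof cases
        case 1
        then have "g v = p (Suc i)" by (simp add: pS)
        then show ?thesis using 1 unfolding P_def
          by (cases "Suc i = j") auto
      next
        case 2
        then show ?thesis using fg by simp
      next
        case 3
        then have "g v = f (p i)" using pmg pmf pV by (metis pS)
        then show ?thesis using 3 unfolding P_def by blast
      next
        case 4
        then show ?thesis using fg wP by simp
      qed
    qed
    have gnQ: "g v \<notin> ?Q" if "v \<in> V - ?Q" for v using that gQ pmg by (metis DiffD1 DiffD2)
    let ?f = "\<lambda>v. if v \<in> P then f v else if v = y then p j else if v = p j then y else g v"
    have "?f v \<in> V \<and> ?f (?f v) = v \<and> E v (?f v)" if vV: "v \<in> V" for v
    proof -
      consider "v \<in> P" | "v = y" | "v = p j" | "v \<in> V - ?Q" using vV by blast
      then show ?thesis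
      proof cases
        case 1
        then show ?thesis using fP pmf[OF vV] Ef[OF vV] xP by auto
      next
        case 2
        then show ?thesis using yP jP yj pjV E pj by auto
      next
        case 3
        then show ?thesis using yP jP yj V E pj by auto
      next
        case 4
        then show ?thesis using gnQ[OF 4] pmg[OF vV] Eg[OF vV] wP by auto
      qed
    qed
    then have "pm_involution V E ?f" unfolding pm_involution_def by blast
    then show ?thesis by blast
  qed
qed

text \<open>Following Lovasz, edges are added as long as no perfect matching arises; then the graph without
  its universal vertices is a disjoint union of cliques.\<close>

lemma weak_Tutte:
  assumes "finite V" "even (card V)"
    and sym: "\<And>u v. E u v \<Longrightarrow> E v u" and irr: "\<And>u. \<not> E u u"
    and "\<nexists>f. pm_involution V E f"
  obtains S and color :: "'a \<Rightarrow> 'a set" where "S \<subseteq> V" "card S + 2 \<le> card (color ` (V - S))"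
    "\<And>u v. u \<in> V - S \<Longrightarrow> v \<in> V - S \<Longrightarrow> E u v \<Longrightarrow> color u = color v"
proof -
  have "\<exists>S (color :: 'a \<Rightarrow> 'a set). S \<subseteq> V \<and> card S + 2 \<le> card (color ` (V - S)) \<and>
    (\<forall>u\<in>V - S. \<forall>v\<in>V - S. E u v \<longrightarrow> color u = color v)"
    using sym irr assms(5)
  proof (induction "card {(u, v). u \<in> V \<and> v \<in> V \<and> \<not> E u v}" arbitrary: E rule: less_induct)
    case less
    define add where "add a b u v \<longleftrightarrow> E u v \<or> (u = a \<and> v = b) \<or> (u = b \<and> v = a)" for a b u v
    \<comment> \<open>Adding \<open>ab\<close> leaves fewer nonadjacent pairs, and a coloring that
      is constant along the edges of the larger graph is constant along those of
      \<open>E\<close>.\<close>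
    have adding: ?case if no: "\<nexists>f. pm_involution V (add a b) f"
      and ab: "a \<in> V" "b \<in> V" "a \<noteq> b" "\<not> E a b" for a b
    proof -
      have "{(u, v). u \<in> V \<and> v \<in> V \<and> \<not> add a b u v} \<subset> {(u, v). u \<in> V \<and> v \<in> V \<and> \<not> E u v}"
        using ab unfolding add_def by auto
      moreover have "finite {(u, v). u \<in> V \<and> v \<in> V \<and> \<not> E u v}"
        by (rule finite_subset[of _ "V \<times> V"]) (use assms(1) in auto)
      ultimately have "card {(u, v). u \<in> V \<and> v \<in> V \<and> \<not> add a b u v}
        < card {(u, v). u \<in> V \<and> v \<in> V \<and> \<not> E u v}" by (rule psubset_card_mono[rotated])
      from less.hyps[OF this] no less.prems ab show ?thesis unfolding add_def by (smt (verit))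
    qed
    define S where "S = {u \<in> V. \<forall>v\<in>V. u \<noteq> v \<longrightarrow> E u v}"
    show ?case
    \<comment> \<open>The configuration is a path \<open>x\<close>, \<open>y\<close>,
      \<open>z\<close> with nonadjacent ends whose middle vertex misses some \<open>w\<close>.
      Without it, adjacency is transitive through vertices outside \<open>S\<close>.\<close>
    proof (cases "\<exists>x y z w. {x, y, z, w} \<subseteq> V \<and> x \<noteq> z \<and> y \<noteq> w \<and> E x y \<and> E y z \<and> \<not> E x z \<and> \<not> E y w")
      case True
      then obtain x y z w where xyzw: "x \<in> V" "y \<in> V" "z \<in> V" "w \<in> V" "x \<noteq> z" "y \<noteq> w"
        "E x y" "E y z" "\<not> E x z" "\<not> E y w" by auto
      show ?thesis
      proof (rule ccontr)
        assume nc: "\<not> ?thesis"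
        obtain f where f: "pm_involution V (add x z) f" using adding[of x z] xyzw nc by blast
        obtain g where g: "pm_involution V (add y w) g" using adding[of y w] xyzw nc by blast
        have f': "f v \<in> V \<and> f (f v) = v \<and> add x z v (f v)" if "v \<in> V" for v
          using f that unfolding pm_involution_def by blast
        have g': "g v \<in> V \<and> g (g v) = v \<and> add y w v (g v)" if "v \<in> V" for v
          using g that unfolding pm_involution_def by blast
        have fxz: "f x = z"
        proof (rule ccontr)
          assume "f x \<noteq> z"
          then have "pm_involution V E f" using f' xyzw less.prems unfolding pm_involution_def add_def
            by metis
          then show False using less.prems by blast
        qed
        have gyw: "g y = w"
        proof (rule ccontr)
          assume "g y \<noteq> w"
          then have "pm_involution V E g" using g' xyzw less.prems unfolding pm_involution_def add_def
            by metis
          then show False using less.prems by blast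
        qed
        have "\<exists>f'. pm_involution V E f'"
        proof (rule pm_involution_alternating_path[where f = f and g = g and x = x and y = y and z = z and w = w])
          show "f v \<in> V \<and> f (f v) = v \<and> f v \<noteq> v" if "v \<in> V" for v
            using f'[OF that] xyzw less.prems unfolding add_def by metis
          show "g v \<in> V \<and> g (g v) = v \<and> g v \<noteq> v" if "v \<in> V" for v
            using g'[OF that] xyzw less.prems unfolding add_def by metis
          show "E v (f v)" if "v \<in> V" "v \<notin> {x, z}" for v
            using f'[OF that(1)] that unfolding add_def by auto
          show "E v (g v)" if "v \<in> V" "v \<notin> {y, w}" for v
            using g'[OF that(1)] that unfolding add_def by auto
          show "f z = x" using f' fxz xyzw by metis
          show "g w = y" using g' gyw xyzw by metis
          show "w \<notin> {x, z}" "y \<notin> {x, z}" using xyzw less.prems by auto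
        qed (use assms xyzw fxz gyw less.prems in auto)
        then show False using less.prems by blast
      qed
    next
      case False
      have SV: "S \<subseteq> V" by (auto simp: S_def)
      \<comment> \<open>The color is the closed neighborhood, which by \<open>trans\<close> is
        common to all vertices of a clique outside \<open>S\<close>.\<close>
      define color where "color u = {v \<in> V. v = u \<or> E u v}" for u
      have trans: "E x z" if "x \<in> V" "z \<in> V" "x \<noteq> z" "y \<in> V - S" "E x y" "E y z" for x y z
        using False that unfolding S_def by blast
      have color_le: "color u \<subseteq> color v" if uv: "u \<in> V - S" "v \<in> V - S" "E u v" for u v
      proof
        fix w assume "w \<in> color u"
        then have w: "w \<in> V" "w = u \<or> E u w" by (auto simp: color_def)
        have "w = v \<or> E v w"
        proof (cases "w = u \<or> w = v")
          case True
          then show ?thesis using less.prems(1)[OF uv(3)] by blast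
        next
          case False
          then show ?thesis using trans[of v w u] w uv less.prems(1)[OF uv(3)] by blast
        qed
        then show "w \<in> color v" using w by (simp add: color_def)
      qed
      have color: "color u = color v" if "u \<in> V - S" "v \<in> V - S" "E u v" for u v
        using color_le[OF that] color_le[OF that(2,1) less.prems(1)[OF that(3)]] by (rule equalityI)
      have "\<not> card (color ` (V - S)) \<le> card S + 1"
      proof
        assume le: "card (color ` (V - S)) \<le> card S + 1"
        have "\<exists>f. pm_involution V E f"
        proof (rule pm_involution_of_few_cliques[OF assms(1) SV assms(2) le])
          show "E u v \<and> E v u" if "u \<in> S" "v \<in> V" "u \<noteq> v" for u v
            using that less.prems(1) by (auto simp: S_def)
          show "E u v" if "u \<in> V - S" "v \<in> V - S" "u \<noteq> v" "color u = color v" for u v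
          proof -
            have "u \<in> color v" using that(1,4) by (auto simp: color_def)
            then have "E v u" using that(3) by (auto simp: color_def)
            then show ?thesis by (rule less.prems(1))
          qed
        qed
        then show False using less.prems by blast
      qed
      then show ?thesis using color SV by (intro exI[of _ S] exI[of _ color]) auto
    qed
  qed
  then show ?thesis using that by blast
qed

subsection \<open>Adjacency eigenvalues\<close>

definition neighbors :: "'a ugraph \<Rightarrow> 'a \<Rightarrow> 'a set" where
  "neighbors G v = {u \<in> vertices G. {v, u} \<in> edges G}"

text \<open>For a complex eigenvector \<open>v\<close> the Hermitian form \<open>?q\<close> is
  \<open>c\<close> times the squared norm of \<open>v\<close>. Symmetry of the real matrix makes
  \<open>?q\<close> its own conjugate, so \<open>c\<close> is real and a root of the real
  characteristic polynomial.\<close>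

lemma symmetric_mat_has_real_eigenvalue:
  fixes A :: "real mat"
  assumes A: "A \<in> carrier_mat n n" and n: "n > 0"
    and sym: "\<And>i j. i < n \<Longrightarrow> j < n \<Longrightarrow> A $$ (i, j) = A $$ (j, i)"
  shows "\<exists>x. eigenvalue A x"
proof -
  let ?A = "map_mat complex_of_real A"
  have A': "?A \<in> carrier_mat n n" using A by simp
  obtain c where c: "eigenvalue ?A c" using spectrum_non_empty[OF A' n] unfolding spectrum_def by blast
  then obtain v where v: "v \<in> carrier_vec n" "v \<noteq> 0\<^sub>v n" "?A *\<^sub>v v = c \<cdot>\<^sub>v v"
    unfolding eigenvalue_def eigenvector_def using A by auto
  have Av: "(\<Sum>j\<in>{0..<n}. complex_of_real (A $$ (i, j)) * v $ j) = c * v $ i" if "i < n" for i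
  proof -
    have "(?A *\<^sub>v v) $ i = (\<Sum>j\<in>{0..<n}. complex_of_real (A $$ (i, j)) * v $ j)"
      using that A v(1) by (auto simp: scalar_prod_def)
    then show ?thesis using v that by simp
  qed
  let ?q = "\<Sum>i\<in>{0..<n}. \<Sum>j\<in>{0..<n}. cnj (v $ i) * (complex_of_real (A $$ (i, j)) * v $ j)"
  have q: "?q = c * complex_of_real (\<Sum>i\<in>{0..<n}. (cmod (v $ i))\<^sup>2)"
  proof -
    have "?q = (\<Sum>i\<in>{0..<n}. cnj (v $ i) * (c * v $ i))"
      by (intro sum.cong refl) (simp add: sum_distrib_left[symmetric] Av)
    also have "\<dots> = (\<Sum>i\<in>{0..<n}. c * complex_of_real ((cmod (v $ i))\<^sup>2))"
      by (intro sum.cong refl) (simp add: complex_norm_square[symmetric] mult_ac)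
    finally show ?thesis by (simp add: sum_distrib_left)
  qed
  have "cnj ?q = (\<Sum>i\<in>{0..<n}. \<Sum>j\<in>{0..<n}. v $ i * (complex_of_real (A $$ (i, j)) * cnj (v $ j)))"
    by simp
  also have "\<dots> = (\<Sum>j\<in>{0..<n}. \<Sum>i\<in>{0..<n}. v $ i * (complex_of_real (A $$ (i, j)) * cnj (v $ j)))"
    by (rule sum.swap)
  also have "\<dots> = ?q"
    by (intro sum.cong refl) (simp add: sym mult_ac)
  finally have qr: "cnj ?q = ?q" .
  obtain i where i: "i < n" "v $ i \<noteq> 0" using v by (metis carrier_vecD eq_vecI index_zero_vec(1) index_zero_vec(2))
  have "(\<Sum>i\<in>{0..<n}. (cmod (v $ i))\<^sup>2) > 0"
    by (rule sum_pos2[of _ i]) (use i in auto)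
  moreover have "cnj c * complex_of_real s = c * complex_of_real s"
    if "s = (\<Sum>i\<in>{0..<n}. (cmod (v $ i))\<^sup>2)" for s
    using qr unfolding q that[symmetric] by simp
  ultimately have "cnj c = c" by (metis less_irrefl mult_right_cancel of_real_eq_0_iff)
  then obtain r where r: "c = complex_of_real r" by (metis Reals_cnj_iff Reals_cases)
  have "poly (char_poly ?A) c = 0" using c eigenvalue_root_char_poly[OF A'] by simp
  then have "complex_of_real (poly (char_poly A) r) = 0"
    unfolding of_real_hom.char_poly_hom[OF A] r by simp
  then have "eigenvalue A r" using eigenvalue_root_char_poly[OF A] by simp
  then show ?thesis by blast
qed

section \<open>The adjacency matrix as an operator on functions of the vertices\<close>

lemma adjacency_matrix_carrier:
  "adjacency_matrix G \<in> carrier_mat (graph_order G) (graph_order G)"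
  by (simp add: adjacency_matrix_def)

lemma bij_betw_vertex_enum:
  assumes "finite (vertices G)"
  shows "bij_betw (vertex_enum G) {0..<graph_order G} (vertices G)"
  unfolding vertex_enum_def graph_order_def
  using someI_ex[OF ex_bij_betw_nat_finite[OF assms]] .

lemma adjacency_matrix_mult_vec:
  assumes "finite (vertices G)" "i < graph_order G"
  shows "(adjacency_matrix G *\<^sub>v vec (graph_order G) (\<lambda>j. x (vertex_enum G j))) $ i =
    sum x (neighbors G (vertex_enum G i))"
proof -
  let ?n = "graph_order G" and ?e = "vertex_enum G"
  have "(adjacency_matrix G *\<^sub>v vec ?n (\<lambda>j. x (?e j))) $ i =
    (\<Sum>j\<in>{0..<?n}. if {?e i, ?e j} \<in> edges G then x (?e j) else 0)"
    using assms(2) by (auto simp: adjacency_matrix_def scalar_prod_def intro!: sum.cong)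
  also have "\<dots> = (\<Sum>u\<in>vertices G. if {?e i, u} \<in> edges G then x u else 0)"
    by (rule sum.reindex_bij_betw[OF bij_betw_vertex_enum[OF assms(1)]])
  also have "\<dots> = sum x (neighbors G (?e i))"
    unfolding neighbors_def using assms(1) by (simp add: sum.inter_filter)
  finally show ?thesis .
qed

text \<open>Transport along \<open>vertex_enum\<close> turns vectors into functions on the vertices,
  so that the arbitrary enumeration disappears from all later arguments.\<close>

lemma eigenvalue_adjacency_matrix_iff:
  assumes fin: "finite (vertices G)"
  shows "eigenvalue (adjacency_matrix G) l \<longleftrightarrow>
    (\<exists>x. (\<exists>v\<in>vertices G. x v \<noteq> 0) \<and> (\<forall>v\<in>vertices G. sum x (neighbors G v) = l * x v))"
    (is "?L \<longleftrightarrow> ?R")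
proof
  let ?n = "graph_order G" and ?e = "vertex_enum G"
  note bij = bij_betw_vertex_enum[OF fin]
  have enum: "\<exists>j<?n. v = ?e j" if "v \<in> vertices G" for v
    using that unfolding bij_betw_imp_surj_on[OF bij, symmetric] by auto
  {
    assume ?L
    then obtain w where w: "w \<in> carrier_vec ?n" "w \<noteq> 0\<^sub>v ?n" "adjacency_matrix G *\<^sub>v w = l \<cdot>\<^sub>v w"
      unfolding eigenvalue_def eigenvector_def using adjacency_matrix_carrier[of G] by auto
    define x where "x u = w $ inv_into {0..<?n} ?e u" for u
    have xe: "x (?e j) = w $ j" if "j < ?n" for j
      unfolding x_def using that bij by (simp add: bij_betw_inv_into_left)
    have wx: "w = vec ?n (\<lambda>j. x (?e j))" using w(1) xe by auto
    obtain i where i: "i < ?n" "w $ i \<noteq> 0"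
      using w by (metis carrier_vecD eq_vecI index_zero_vec(1) index_zero_vec(2))
    have "sum x (neighbors G v) = l * x v" if v: "v \<in> vertices G" for v
    proof -
      obtain j where j: "j < ?n" "v = ?e j" using enum[OF v] by blast
      have "sum x (neighbors G v) = (adjacency_matrix G *\<^sub>v w) $ j"
        unfolding j(2) using adjacency_matrix_mult_vec[OF fin j(1)] wx by metis
      then show ?thesis using w j xe by simp
    qed
    moreover have "?e i \<in> vertices G" "x (?e i) \<noteq> 0" using i xe bij by (auto simp: bij_betw_def)
    ultimately show ?R by blast
  }
  {
    assume ?R
    then obtain x v where x: "v \<in> vertices G" "x v \<noteq> 0"
      "\<And>v. v \<in> vertices G \<Longrightarrow> sum x (neighbors G v) = l * x v" by blast
    let ?w = "vec ?n (\<lambda>j. x (?e j))"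
    obtain j where j: "j < ?n" "v = ?e j" using x(1) enum by blast
    have "?w $ j \<noteq> 0" using x j by simp
    then have "?w \<noteq> 0\<^sub>v ?n" using j by (metis index_zero_vec(1))
    moreover have "adjacency_matrix G *\<^sub>v ?w = l \<cdot>\<^sub>v ?w"
    proof (rule eq_vecI)
      fix i assume "i < dim_vec (l \<cdot>\<^sub>v ?w)"
      then have i: "i < ?n" by simp
      then have "?e i \<in> vertices G" using bij by (auto simp: bij_betw_def)
      then show "(adjacency_matrix G *\<^sub>v ?w) $ i = (l \<cdot>\<^sub>v ?w) $ i"
        using adjacency_matrix_mult_vec[OF fin i, of x] x(3) i by simp
    qed (simp add: adjacency_matrix_def)
    ultimately show ?L unfolding eigenvalue_def eigenvector_def
      using adjacency_matrix_carrier[of G] by (metis carrier_matD(1) vec_carrier)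
  }
qed

lemma finite_adjacency_eigenvalues: "finite {x. eigenvalue (adjacency_matrix G) x}"
  using card_finite_spectrum(1)[OF adjacency_matrix_carrier[of G]] unfolding spectrum_def by simp

lemma graph_spectral_radius_ge:
  "eigenvalue (adjacency_matrix G) x \<Longrightarrow> x \<le> graph_spectral_radius G"
  unfolding graph_spectral_radius_def by (intro Max_ge finite_adjacency_eigenvalues) simp

lemma graph_spectral_radius_eigenvalue:
  assumes "finite (vertices G)" "vertices G \<noteq> {}"
  shows "eigenvalue (adjacency_matrix G) (graph_spectral_radius G)"
proof -
  have "\<exists>x. eigenvalue (adjacency_matrix G) x"
  proof (rule symmetric_mat_has_real_eigenvalue[OF adjacency_matrix_carrier])
    show "graph_order G > 0" using assms by (simp add: graph_order_def card_gt_0_iff)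
  qed (simp add: adjacency_matrix_def insert_commute)
  then show ?thesis
    using Max_in[OF finite_adjacency_eigenvalues[of G]] unfolding graph_spectral_radius_def by auto
qed

text \<open>The adjacency operator is self-adjoint, because the edge relation is symmetric.\<close>

lemma sum_neighbors_swap:
  assumes "finite (vertices G)"
  shows "(\<Sum>v\<in>vertices G. f v * sum g (neighbors G v)) =
    (\<Sum>v\<in>vertices G. sum f (neighbors G v) * (g v :: real))"
proof -
  let ?V = "vertices G"
  have "(\<Sum>v\<in>?V. f v * sum g (neighbors G v)) =
    (\<Sum>v\<in>?V. \<Sum>u\<in>?V. if {v, u} \<in> edges G then f v * g u else 0)"
    unfolding neighbors_def using assms
    by (auto simp: sum_distrib_left sum.inter_filter intro!: sum.cong)
  also have "\<dots> = (\<Sum>u\<in>?V. \<Sum>v\<in>?V. if {v, u} \<in> edges G then f v * g u else 0)"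
    by (rule sum.swap)
  also have "\<dots> = (\<Sum>u\<in>?V. sum f (neighbors G u) * g u)"
    unfolding neighbors_def using assms
    by (auto simp: sum_distrib_right sum.inter_filter insert_commute intro!: sum.cong)
  finally show ?thesis .
qed

text \<open>Pairing the supersolution \<open>z\<close> with the absolute value of an eigenvector replaces
  Perron--Frobenius.\<close>

lemma graph_spectral_radius_less:
  assumes G: "simple_graph G" and conn: "graph_connected G"
    and pos: "\<And>v. v \<in> vertices G \<Longrightarrow> z v > 0"
    and super: "\<And>v. v \<in> vertices G \<Longrightarrow> sum z (neighbors G v) \<le> \<theta> * z v"
    and strict: "w \<in> vertices G" "sum z (neighbors G w) < \<theta> * z w"
  shows "graph_spectral_radius G < \<theta>"
proof (rule ccontr)
  let ?V = "vertices G" and ?l = "graph_spectral_radius G"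
  have fin: "finite ?V" using G by (simp add: simple_graph_def)
  assume "\<not> ?l < \<theta>"
  then have ge: "?l \<ge> \<theta>" by simp
  have finN: "finite (neighbors G v)" for v using fin by (simp add: neighbors_def)
  have "sum z (neighbors G w) \<ge> 0" using pos by (intro sum_nonneg) (auto simp: neighbors_def less_imp_le)
  then have "\<theta> * z w > 0" using strict by simp
  then have th: "\<theta> > 0" using pos[OF strict(1)] by (simp add: zero_less_mult_iff)
  have "eigenvalue (adjacency_matrix G) ?l"
    using graph_spectral_radius_eigenvalue fin conn unfolding graph_connected_def by blast
  then obtain x v0 where x: "v0 \<in> ?V" "x v0 \<noteq> 0"
    "\<And>v. v \<in> ?V \<Longrightarrow> sum x (neighbors G v) = ?l * x v"
    using eigenvalue_adjacency_matrix_iff[OF fin] by blast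
  \<comment> \<open>By the triangle inequality the absolute values form a subsolution for
    \<open>\<theta>\<close>, opposite to the supersolution \<open>z\<close>.\<close>
  define y where "y v = \<bar>x v\<bar>" for v
  have sub: "\<theta> * y v \<le> sum y (neighbors G v)" if "v \<in> ?V" for v
  proof -
    have "\<theta> * y v \<le> ?l * y v" using ge by (simp add: y_def mult_right_mono)
    also have "\<dots> = \<bar>sum x (neighbors G v)\<bar>" using x(3)[OF that] ge th by (simp add: y_def abs_mult)
    also have "\<dots> \<le> sum y (neighbors G v)" unfolding y_def by (rule sum_abs)
    finally show ?thesis .
  qed
  \<comment> \<open>By self-adjointness the defects of \<open>y\<close> and \<open>z\<close>,
    weighted by each other, sum to zero. All terms are nonnegative, so both defects vanish at every
    vertex.\<close>
  have "(\<Sum>v\<in>?V. z v * (sum y (neighbors G v) - \<theta> * y v) + (\<theta> * z v - sum z (neighbors G v)) * y v)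
    = (\<Sum>v\<in>?V. z v * sum y (neighbors G v)) - (\<Sum>v\<in>?V. sum z (neighbors G v) * y v)"
    by (simp add: sum_subtractf[symmetric] algebra_simps)
  also have "\<dots> = 0" using sum_neighbors_swap[OF fin, of z y] by simp
  finally have sum0: "(\<Sum>v\<in>?V. z v * (sum y (neighbors G v) - \<theta> * y v)
    + (\<theta> * z v - sum z (neighbors G v)) * y v) = 0" .
  have nn1: "z v * (sum y (neighbors G v) - \<theta> * y v) \<ge> 0" if "v \<in> ?V" for v
    using sub[OF that] pos[OF that] by simp
  have nn2: "(\<theta> * z v - sum z (neighbors G v)) * y v \<ge> 0" if "v \<in> ?V" for v
    using super[OF that] by (simp add: y_def)
  have each: "z v * (sum y (neighbors G v) - \<theta> * y v) + (\<theta> * z v - sum z (neighbors G v)) * y v = 0"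
    if "v \<in> ?V" for v
    using sum_nonneg_0[OF fin _ sum0 that] nn1 nn2 by fastforce
  have eq: "sum y (neighbors G v) = \<theta> * y v" if "v \<in> ?V" for v
    using each[OF that] nn1[OF that] nn2[OF that] pos[OF that] sub[OF that]
    by (smt (verit) mult_pos_pos)
  have yw: "y w = 0"
    using each[OF strict(1)] nn1[OF strict(1)] strict(2) nn2[OF strict(1)]
    by (smt (verit) y_def mult_pos_pos abs_ge_zero)
  \<comment> \<open>Where \<open>y\<close> vanishes, its neighbor sum vanishes and hence so does
    \<open>y\<close> at each neighbor; connectedness spreads the zero from \<open>w\<close> to the
    whole graph.\<close>
  have zero: "v \<in> ?V \<longrightarrow> y v = 0" if "(w, v) \<in> {(x, y). {x, y} \<in> edges G}\<^sup>*" for v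
    using that
  proof (induction rule: rtrancl_induct)
    case base
    then show ?case using yw by simp
  next
    case (step b c)
    then have bc: "b \<in> ?V" "c \<in> ?V" "{b, c} \<in> edges G" using G unfolding simple_graph_def by auto
    then have "sum y (neighbors G b) = 0" "c \<in> neighbors G b"
      using step.IH eq by (auto simp: neighbors_def)
    then show ?case using sum_nonneg_0[OF finN, of b y c] by (simp add: y_def)
  qed
  then show False using conn strict(1) x unfolding graph_connected_def y_def by fastforce
qed

subsection \<open>Estimates for the test vector\<close>

text \<open>The function \<open>x / (c - x)\<close> is convex, and the right-hand side is an affine
  function that agrees with it at \<open>p\<close> and \<open>N\<close>. The numerator of the
  difference is \<open>c * ((x - p) * (N - x))\<close>, which also settles equality.\<close>

lemma chord_bound:
  fixes c p x N :: real
  assumes "0 < p" "p \<le> x" "x \<le> N" "N < c"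
  shows "x / (c - x) \<le> (c * x - p * N) / ((c - p) * (c - N))"
    and "x / (c - x) = (c * x - p * N) / ((c - p) * (c - N)) \<Longrightarrow> x = p \<or> x = N"
proof -
  have pos: "c - x > 0" "(c - p) * (c - N) > 0" "c > 0" using assms by auto
  have id: "(c * x - p * N) * (c - x) - x * ((c - p) * (c - N)) = c * ((x - p) * (N - x))"
    by (simp add: algebra_simps)
  have "c * ((x - p) * (N - x)) \<ge> 0" using assms pos by simp
  then show "x / (c - x) \<le> (c * x - p * N) / ((c - p) * (c - N))"
    using id by (subst frac_le_eq) (use pos in \<open>auto simp: divide_nonpos_pos\<close>)
  assume "x / (c - x) = (c * x - p * N) / ((c - p) * (c - N))"
  then have "x * ((c - p) * (c - N)) = (c * x - p * N) * (c - x)"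
    using pos frac_eq_eq[of "c - x" "(c - p) * (c - N)"] by (metis less_irrefl)
  then have "c * ((x - p) * (N - x)) = 0" using id by simp
  then show "x = p \<or> x = N" using pos by auto
qed

section \<open>Sums over a partition into color classes\<close>

lemma sum_over_color_classes:
  fixes F :: "real \<Rightarrow> real"
  assumes "finite W"
  shows "(\<Sum>v\<in>W. F (real (card {u\<in>W. color u = color v}))) =
    (\<Sum>C\<in>color ` W. real (card {u\<in>W. color u = C}) * F (real (card {u\<in>W. color u = C})))"
proof -
  have "(\<Sum>v\<in>W. F (real (card {u\<in>W. color u = color v}))) =
    (\<Sum>C\<in>color ` W. \<Sum>v\<in>{v\<in>W. color v = C}. F (real (card {u\<in>W. color u = color v})))"
    by (rule sum.image_gen[OF assms])
  also have "\<dots> = (\<Sum>C\<in>color ` W. \<Sum>v\<in>{v\<in>W. color v = C}. F (real (card {u\<in>W. color u = C})))"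
    by (intro sum.cong refl) auto
  finally show ?thesis by simp
qed

lemma sum_color_class_sizes:
  assumes "finite W"
  shows "(\<Sum>C\<in>color ` W. real (card {u\<in>W. color u = C})) = real (card W)"
  using sum_over_color_classes[OF assms, of "\<lambda>_. 1" color] by simp

text \<open>At least \<open>a + 1\<close> other classes take \<open>p\<close> vertices each, which
  leaves at most \<open>N\<close>.\<close>

lemma color_class_size_le:
  fixes p N :: real and a :: nat and W :: "'a set" and color :: "'a \<Rightarrow> 'b"
  defines "csize \<equiv> \<lambda>C. real (card {u\<in>W. color u = C})"
  assumes fin: "finite W" and p: "0 < p"
    and lower: "\<And>v. v \<in> W \<Longrightarrow> p \<le> csize (color v)"
    and total: "real (card W) = (real a + 1) * p + N"
    and classes: "a + 2 \<le> card (color ` W)"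
    and v: "v \<in> W"
  shows "csize (color v) \<le> N"
proof -
  let ?Q = "color ` W" and ?C = "color v"
  let ?q = "real (card ?Q)"
  have finQ: "finite ?Q" using fin by simp
  have C: "?C \<in> ?Q" using v by simp
  have lowQ: "p \<le> csize C" if "C \<in> ?Q" for C using that lower by auto
  have "(\<Sum>D\<in>?Q - {?C}. p) \<le> (\<Sum>D\<in>?Q - {?C}. csize D)" using lowQ by (intro sum_mono) auto
  moreover have "(\<Sum>D\<in>?Q. csize D) = csize ?C + (\<Sum>D\<in>?Q - {?C}. csize D)"
    using finQ C by (rule sum.remove)
  moreover have "(\<Sum>D\<in>?Q - {?C}. p) = (?q - 1) * p"
    using finQ C classes by (simp add: of_nat_diff)
  moreover have "(real a + 1) * p \<le> (?q - 1) * p"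
    using classes p by (intro mult_right_mono) auto
  ultimately show ?thesis
    using sum_color_class_sizes[OF fin, of color] total unfolding csize_def by linarith
qed

text \<open>Grouped by classes, the sum consists of terms \<open>x / (c - x)\<close>, each bounded
  by its chord between \<open>p\<close> and \<open>N\<close>. Equality forces the least number of
  classes and puts every class size at an end of the chord.\<close>

lemma color_class_sum_bound:
  fixes c p N :: real and a :: nat and W :: "'a set" and color :: "'a \<Rightarrow> 'b"
  defines "csize \<equiv> \<lambda>C. real (card {u\<in>W. color u = C})"
  assumes fin: "finite W" and p: "0 < p" and N: "N < c"
    and lower: "\<And>v. v \<in> W \<Longrightarrow> p \<le> csize (color v)"
    and total: "real (card W) = (real a + 1) * p + N"
    and classes: "a + 2 \<le> card (color ` W)"
  shows "(\<Sum>v\<in>W. 1 / (c - csize (color v))) \<le> (real a + 1) * p / (c - p) + N / (c - N)" (is "?S \<le> ?B")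
    and "(\<Sum>v\<in>W. 1 / (c - csize (color v))) = (real a + 1) * p / (c - p) + N / (c - N) \<Longrightarrow>
      card (color ` W) = a + 2 \<and> (\<forall>v\<in>W. csize (color v) = p \<or> csize (color v) = N)"
proof -
  let ?Q = "color ` W"
  let ?q = "real (card ?Q)"
  have finQ: "finite ?Q" using fin by simp
  have tot: "(\<Sum>C\<in>?Q. csize C) = real (card W)"
    using sum_color_class_sizes[OF fin, of color] unfolding csize_def .
  have lowQ: "p \<le> csize C" if "C \<in> ?Q" for C using that lower by auto
  have upQ: "csize C \<le> N" if "C \<in> ?Q" for C
    using that color_class_size_le[OF fin p _ total classes] lower unfolding csize_def by blast
  have "?Q \<noteq> {}" using classes by auto
  then have pN: "p \<le> N" using lowQ upQ by (metis all_not_in_conv order_trans)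
  let ?D = "(c - p) * (c - N)"
  have D: "?D > 0" using p N pN by simp
  have S: "?S = (\<Sum>C\<in>?Q. csize C / (c - csize C))"
    using sum_over_color_classes[OF fin, of "\<lambda>x. 1 / (c - x)" color] unfolding csize_def by simp
  let ?R = "\<lambda>C. (c * csize C - p * N) / ?D"
  have le: "csize C / (c - csize C) \<le> ?R C" if "C \<in> ?Q" for C
    by (rule chord_bound(1)[OF p lowQ[OF that] upQ[OF that] N])
  \<comment> \<open>Since the total size is fixed, the sum of the chords depends only on the number
    \<open>?q\<close> of classes and decreases in it; at \<open>a + 2\<close> classes it is
    \<open>?B\<close>.\<close>
  have R: "sum ?R ?Q = (c * ((real a + 1) * p + N) - ?q * (p * N)) / ?D"
    by (simp add: sum_divide_distrib[symmetric] sum_subtractf sum_distrib_left[symmetric] tot total)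
  have B: "?B = (c * ((real a + 1) * p + N) - (real a + 2) * (p * N)) / ?D"
    using N pN by (simp add: divide_simps) (simp add: algebra_simps)
  have SR: "?S \<le> sum ?R ?Q" unfolding S by (rule sum_mono) (rule le)
  have RB: "sum ?R ?Q \<le> ?B"
    unfolding R B using D classes p pN
    by (intro divide_right_mono diff_left_mono mult_right_mono) auto
  show "?S \<le> ?B" using SR RB by simp
  assume eq: "?S = ?B"
  then have "sum ?R ?Q = ?B" using SR RB by simp
  then have "?q * (p * N) = (real a + 2) * (p * N)"
    unfolding R B using N pN by auto
  then have "?q = real a + 2" using p pN by simp
  then have q: "card ?Q = a + 2" by linarith
  have "(\<Sum>C\<in>?Q. ?R C - csize C / (c - csize C)) = 0"
    using eq SR RB S by (simp add: sum_subtractf)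
  then have "?R C - csize C / (c - csize C) = 0" if "C \<in> ?Q" for C
    using sum_nonneg_0[OF finQ _ _ that, of "\<lambda>C. ?R C - csize C / (c - csize C)"] le by simp
  then have "csize C = p \<or> csize C = N" if "C \<in> ?Q" for C
    using chord_bound(2)[OF p lowQ[OF that] upQ[OF that] N] that by simp
  then show "card ?Q = a + 2 \<and> (\<forall>v\<in>W. csize (color v) = p \<or> csize (color v) = N)" using q by auto
qed

text \<open>This prepares the assumption \<open>(t + 2) * \<delta> + t + 2 \<le> L\<close> of
  \<open>excess_many_classes\<close>, where \<open>L = n - t - 2\<close>. For small \<open>t\<close>
  the linear bound carries most of the weight, for \<open>t \<ge> 3\<close> the cubic one.\<close>

lemma order_lower_bound_linear:
  fixes n \<delta> k t :: nat
  assumes "k \<ge> 1" "\<delta> = 2 * k + t" "even n" "3 * \<delta> + 5 * t + 4 \<le> n" "\<delta> * t\<^sup>2 + \<delta> \<le> n + 1"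
  shows "(t + 2) * \<delta> + 2 * t + 4 \<le> n"
proof -
  consider "t = 0" | "t = 1" | "t = 2" | "t \<ge> 3" by linarith
  then show ?thesis
  proof cases
    case 3
    \<comment> \<open>At \<open>\<delta> = 8\<close> the two bounds give only 39 instead of the
      required 40; parity of \<open>n\<close> closes the gap.\<close>
    obtain m where "n = 2 * m" using assms(3) by (rule evenE)
    then show ?thesis using 3 assms by simp presburger
  next
    case 4
    have "3 * t \<le> t\<^sup>2" using 4 by (simp add: power2_eq_square)
    then have "\<delta> * (3 * t) \<le> \<delta> * t\<^sup>2" by simp
    then have n: "3 * (\<delta> * t) + \<delta> \<le> n + 1" using assms by (simp add: algebra_simps)
    have "(t + 2) * 5 \<le> (t + 2) * \<delta>" "3 * (t + 2) \<le> t * \<delta>"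
      using assms 4 mult_le_mono[of 3 t "t + 2" \<delta>] by auto
    then show ?thesis using n 4 assms by (simp add: algebra_simps)
  qed (use assms in auto)
qed

text \<open>The equation satisfied by \<open>\<epsilon>\<close> below says that \<open>L + \<epsilon>\<close> is an eigenvalue of the extremal
  graph, where \<open>L = n - t - 2\<close> is the spectral radius of its largest clique.\<close>

lemma exists_eigenvalue_excess:
  fixes L \<delta> t :: real
  assumes "t \<ge> 0" "\<delta> > 0" "L \<ge> \<delta>"
  shows "\<exists>\<epsilon>>0. \<epsilon> * (L + \<epsilon> + 1) * (L + \<epsilon>) = (t + 1) * \<delta> * (\<delta> + \<epsilon>)"
proof -
  let ?f = "\<lambda>e. e * (L + e + 1) * (L + e) - (t + 1) * \<delta> * (\<delta> + e)"
  have f0: "?f 0 < 0" using assms by (simp add: mult_pos_pos)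
  have "(t + 1) * (\<delta> * (\<delta> + (t + 1))) \<le> (t + 1) * ((L + (t + 1)) * (L + (t + 1) + 1))"
    using assms by (intro mult_left_mono mult_mono) auto
  then have f1: "?f (t + 1) \<ge> 0" by (simp add: mult_ac)
  have "\<exists>e\<ge>0. e \<le> t + 1 \<and> ?f e = 0"
    by (rule IVT) (use f0 f1 assms in \<open>auto intro!: continuous_intros\<close>)
  then obtain e where "e \<ge> 0" "?f e = 0" by blast
  then have "e > 0" "?f e = 0" using f0 by (auto simp: less_le)
  then show ?thesis by auto
qed

text \<open>The left-hand side is the value at a vertex of \<open>S\<close> of the adjacency operator applied to the
  test vector, minus \<open>L + \<epsilon>\<close>, when one class has csize \<open>N\<close> and \<open>R / p\<close> classes have csize \<open>p\<close>.\<close>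

lemma extremal_partition_value:
  fixes L \<epsilon> s d R p :: real
  assumes "s > 0" "d \<ge> 0" "\<epsilon> > 0" "N = L + 1 - s - d"
  shows "s * (R / (L + \<epsilon> + 1 - p) + N / (L + \<epsilon> + 1 - N)) + s - 1 - (L + \<epsilon>) =
    R * s / (L + \<epsilon> + 1 - p) - (d + \<epsilon>) * (L + \<epsilon> + 1) / (s + d + \<epsilon>)"
proof -
  have e: "L + \<epsilon> + 1 - N = s + d + \<epsilon>" using assms by simp
  have L: "L = N + s + d - 1" using assms by simp
  have "s + d + \<epsilon> \<noteq> 0" using assms by simp
  then have "s * N / (s + d + \<epsilon>) + s - 1 - (L + \<epsilon>) = - ((d + \<epsilon>) * (L + \<epsilon> + 1) / (s + d + \<epsilon>))"
    unfolding L by (simp add: field_simps)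
  then show ?thesis unfolding e by (simp add: algebra_simps)
qed

text \<open>\<open>key\<close> is the claim at \<open>\<epsilon> = 0\<close> with denominators
  cleared. Because \<open>d < s + d\<close>, it implies \<open>R * s < ?X\<close>, so increasing
  \<open>\<epsilon>\<close> adds more on the right than on the left.\<close>

lemma extremal_partition_strict:
  fixes L \<epsilon> s d R p :: real
  assumes "s > 0" "d > 0" "\<epsilon> > 0" "R > 0" "p > 0" "L + 1 - p > 0"
    and key: "R * s * (s + d) \<le> d * ((L + 1) * (L + 1 - p))"
  shows "R * s / (L + \<epsilon> + 1 - p) < (d + \<epsilon>) * (L + \<epsilon> + 1) / (s + d + \<epsilon>)"
proof -
  let ?X = "(L + 1) * (L + 1 - p)"
  have X: "?X > 0" using assms by (intro mult_pos_pos) auto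
  have "R * s * d < R * s * (s + d)" using assms by simp
  also have "\<dots> \<le> d * ?X" by (rule key)
  finally have "R * s < ?X" using assms(2) by (simp add: mult.commute[of d])
  then have "R * s * \<epsilon> < \<epsilon> * ?X" using assms(3) by (simp add: mult.commute)
  then have "R * s * (s + d + \<epsilon>) < (d + \<epsilon>) * ?X" using key by (simp add: algebra_simps)
  also have "\<dots> \<le> (d + \<epsilon>) * ((L + \<epsilon> + 1) * (L + \<epsilon> + 1 - p))"
    using assms by (intro mult_left_mono mult_mono) auto
  finally show ?thesis using assms by (simp add: divide_simps mult_ac)
qed

text \<open>This is \<open>key\<close> for \<open>a > t\<close>, where \<open>d = a - t\<close>,
  \<open>s = \<delta> + d\<close> and \<open>p = 1\<close>.\<close>

lemma excess_many_classes:
  fixes \<delta> t d L :: real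
  assumes "t \<ge> 0" "\<delta> \<ge> 0" "d \<ge> 1" and L: "\<delta> + 2 * d \<le> L" "\<delta> + 2 * (t + 2) \<le> L"
    and n: "(t + 2) * \<delta> + t + 2 \<le> L"
  shows "(t + d + 1) * (\<delta> + d) * (\<delta> + d + d) \<le> d * ((L + 1) * (L + 1 - 1))"
proof -
  define D where "D = (L - \<delta>) / 2"
  have LD: "L = \<delta> + 2 * D" by (simp add: D_def field_simps)
  \<comment> \<open>The next inequality is concave in \<open>d\<close> as a lower bound for zero,
    and at \<open>d = 1\<close> it is the assumption \<open>n\<close>; these two products account
    for the growth from \<open>1\<close> to \<open>d\<close>.\<close>
  have "(d - 1) * (D - d) \<ge> 0" "(d - 1) * (D - (t + 2)) \<ge> 0" using assms unfolding LD by auto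
  then have "(t + d + 1) * (\<delta> + d) \<le> d * L" using n unfolding LD by (simp add: algebra_simps)
  then have "(t + d + 1) * (\<delta> + d) * (\<delta> + d + d) \<le> d * L * (L + 1)"
    by (rule mult_mono) (use assms in auto)
  then show ?thesis by (simp add: mult_ac)
qed

text \<open>This is \<open>key\<close> for \<open>0 < a < t\<close>, where \<open>b = t - a\<close>,
  \<open>d = a * b\<close> and \<open>p = b + 1\<close>; the assumption on \<open>L\<close> is the
  cubic order bound. Three estimates are multiplied:
  \<open>(a + 1) * (b + 1) \<le> 4 * a * b\<close>, \<open>4 * s \<le> L + 1\<close> and
  \<open>s + a * b \<le> L + 1 - (b + 1)\<close>.\<close>

lemma excess_few_classes:
  fixes s a b L :: real
  assumes a: "a \<ge> 1" and b: "b \<ge> 1" and s: "s \<ge> a + 2"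
    and L: "L \<ge> (s + b) * (a + b)\<^sup>2 + (s + b) - 3 - (a + b)"
  shows "(a + 1) * (b + 1) * s * (s + a * b) \<le> a * b * ((L + 1) * (L + 1 - (b + 1)))"
    and "L + 1 - (b + 1) > 0"
proof -
  let ?t = "a + b" and ?d = "s + b"
  have t: "?t\<^sup>2 \<ge> 4" using power_mono[of 2 ?t 2] a b by simp
  have ab: "(a - 1) * (b - 1) \<ge> 0" using a b by simp
  have s4: "4 * s \<le> ?d * ?t\<^sup>2" using mult_mono[of s ?d 4 "?t\<^sup>2"] t s a b by simp
  have L1: "4 * s \<le> L + 1" using s4 L s by simp
  have "(?d - 1) * (?t\<^sup>2 - 2) \<ge> 3 * 2" using s a b t by (intro mult_mono) auto
  then have "?d * ?t\<^sup>2 \<ge> 2 * ?d + ?t\<^sup>2" by (simp add: algebra_simps)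
  moreover have "?t\<^sup>2 \<ge> a * b" using a b by (simp add: power2_eq_square algebra_simps)
  ultimately have "?d * ?t\<^sup>2 \<ge> 2 * ?d + a * b" by linarith
  then have L2: "s + a * b \<le> L + 1 - (b + 1)" using L s a b by simp
  then show pos: "L + 1 - (b + 1) > 0" using s a b by (smt (verit) mult_nonneg_nonneg)
  have "(a + 1) * (b + 1) \<le> a * b * 4" using ab a b by (simp add: algebra_simps)
  moreover have "4 * s * (s + a * b) \<le> (L + 1) * (L + 1 - (b + 1))"
    using L1 L2 s a b by (intro mult_mono) auto
  ultimately have "(a + 1) * (b + 1) * (4 * s * (s + a * b)) \<le> a * b * 4 * ((L + 1) * (L + 1 - (b + 1)))"
    by (rule mult_mono) (use s a b in auto)
  then have "4 * ((a + 1) * (b + 1) * s * (s + a * b)) \<le> 4 * (a * b * ((L + 1) * (L + 1 - (b + 1))))"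
    by (simp only: mult_ac)
  then show "(a + 1) * (b + 1) * s * (s + a * b) \<le> a * b * ((L + 1) * (L + 1 - (b + 1)))"
    by linarith
qed

text \<open>For \<open>a = 0 < t\<close> the parameter \<open>d\<close> is 0 and \<open>key\<close>
  fails, so the equation for \<open>\<epsilon>\<close> takes its place.\<close>

lemma excess_two_classes:
  fixes k2 t L \<epsilon> :: real
  assumes "k2 > 0" "t > 0" "\<epsilon> > 0" and L: "L \<ge> k2 + t"
    and eq: "\<epsilon> * (L + \<epsilon> + 1) * (L + \<epsilon>) = (t + 1) * (k2 + t) * (k2 + t + \<epsilon>)"
  shows "(t + 1) * k2 / (L + \<epsilon> + 1 - (t + 1)) < \<epsilon> * (L + \<epsilon> + 1) / (k2 + \<epsilon>)"
proof -
  let ?th = "L + \<epsilon>"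
  have th: "?th > k2 + t" using assms by simp
  have "k2 * ?th \<le> (k2 + t) * (?th - t)"
    using mult_left_mono[of "k2 + t" ?th t] th assms by (simp add: algebra_simps)
  then have "k2 * ?th * (k2 + \<epsilon>) < (k2 + t) * (?th - t) * (k2 + t + \<epsilon>)"
    using th assms by (intro mult_le_less_imp_less) auto
  then have "(t + 1) * (k2 * ?th * (k2 + \<epsilon>)) < (t + 1) * ((k2 + t) * (?th - t) * (k2 + t + \<epsilon>))"
    using assms by simp
  also have "\<dots> = \<epsilon> * (?th + 1) * (?th - t) * ?th" using eq by (simp add: mult_ac)
  finally have "(t + 1) * k2 * (k2 + \<epsilon>) * ?th < \<epsilon> * (?th + 1) * (?th - t) * ?th" by (simp add: mult_ac)
  then have "(t + 1) * k2 * (k2 + \<epsilon>) < \<epsilon> * (?th + 1) * (?th - t)"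
    using th assms by (simp add: mult_less_cancel_right)
  then show ?thesis using th assms by (simp add: divide_simps mult_ac)
qed

text \<open>In the proof, \<open>d\<close> is the amount by which \<open>S\<close> and a class of
  size \<open>N\<close> together fall short of \<open>L + 1\<close>, the order of the largest clique
  in the extremal graph. It equals \<open>a - t\<close> for \<open>a \<ge> t\<close> and
  \<open>a * (t - a)\<close> otherwise, which leads to the four cases.\<close>

lemma separator_value_bound:
  fixes n k t \<delta> a :: nat and \<epsilon> :: real
  defines "L \<equiv> real n - real t - 2" and "s \<equiv> 2 * k + a" and "p \<equiv> if t \<le> a then 1 else t - a + 1"
  defines "N \<equiv> real n - real s - (real a + 1) * real p"
  assumes k: "k \<ge> 1" and \<delta>: "\<delta> = 2 * k + t" and n: "even n" "3 * \<delta> + 5 * t + 4 \<le> n" "\<delta> * t\<^sup>2 + \<delta> \<le> n + 1"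
    and \<epsilon>: "\<epsilon> > 0" "\<epsilon> * (L + \<epsilon> + 1) * (L + \<epsilon>) = (real t + 1) * real \<delta> * (real \<delta> + \<epsilon>)"
    and N: "N \<ge> real p"
  shows "real s * ((real a + 1) * real p / (L + \<epsilon> + 1 - real p) + N / (L + \<epsilon> + 1 - N)) + real s - 1
      \<le> L + \<epsilon>" (is "?v \<le> _")
    and "a \<noteq> t \<Longrightarrow> real s * ((real a + 1) * real p / (L + \<epsilon> + 1 - real p) + N / (L + \<epsilon> + 1 - N)) + real s - 1
      < L + \<epsilon>"
    and "N < L + \<epsilon> + 1"
proof -
  define d where "d = real n - real t - 1 - real s - N"
  have s: "real s = 2 * real k + real a" "real s > 0" using k by (auto simp: s_def)
  have Ld: "N = L + 1 - real s - d" by (simp add: L_def d_def)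
  have Lbig: "L \<ge> 3 * real \<delta> + 4 * real t + 2" using n(2) unfolding L_def by linarith
  have \<delta>2: "real \<delta> = 2 * real k + real t" "real k \<ge> 1" using \<delta> k by auto
  let ?T = "(real a + 1) * real p * real s / (L + \<epsilon> + 1 - real p)"
  have main: "d \<ge> 0 \<and> ?T \<le> (d + \<epsilon>) * (L + \<epsilon> + 1) / (real s + d + \<epsilon>) \<and>
    (a \<noteq> t \<longrightarrow> ?T < (d + \<epsilon>) * (L + \<epsilon> + 1) / (real s + d + \<epsilon>))"
  proof -
    consider "a = t" | "a > t" | "a < t" "a > 0" | "a = 0" "t > 0" by linarith
    then show ?thesis
    proof cases
      case 1
      have p: "p = 1" using 1 by (simp add: p_def)
      have deq: "d = 0" using 1 p unfolding d_def N_def s(1) by simp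
      have "real s = real \<delta>" using 1 \<delta>2 s by simp
      \<comment> \<open>With \<open>d = 0\<close>, \<open>p = 1\<close> and
        \<open>s = \<delta>\<close> this is the equation for \<open>\<epsilon>\<close> divided by
        its denominators.\<close>
      then have "?T = (d + \<epsilon>) * (L + \<epsilon> + 1) / (real s + d + \<epsilon>)"
        unfolding deq using \<epsilon> Lbig \<delta>2 1 p by (simp add: divide_simps mult_ac)
      then show ?thesis using deq 1 by simp
    next
      case 2
      have p: "p = 1" using 2 by (simp add: p_def)
      have deq: "d = real a - real t" using p unfolding d_def N_def s(1) by simp
      have d1: "d \<ge> 1" unfolding deq using 2 by linarith
      have sd: "real s = real \<delta> + d" unfolding deq using \<delta>2 s by simp
      have "real ((t + 2) * \<delta> + 2 * t + 4) \<le> real n"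
        using order_lower_bound_linear[OF k \<delta> n] by (simp only: of_nat_le_iff)
      then have n4: "(real t + 2) * real \<delta> + 2 * real t + 4 \<le> real n"
        by (simp add: algebra_simps)
      have L2: "L \<ge> real \<delta> + 2 * d" using N deq p unfolding N_def L_def s(1) \<delta>2 by simp
      have key: "(real t + d + 1) * (real \<delta> + d) * (real \<delta> + d + d) \<le> d * ((L + 1) * (L + 1 - 1))"
        using n4 Lbig L2 d1 \<delta>2 by (intro excess_many_classes) (auto simp: L_def)
      have "(real a + 1) * real p = real t + d + 1" unfolding deq p by simp
      then have "(real a + 1) * real p * real s * (real s + d) \<le> d * ((L + 1) * (L + 1 - real p))"
        using key unfolding sd p by simp
      then have "?T < (d + \<epsilon>) * (L + \<epsilon> + 1) / (real s + d + \<epsilon>)"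
        using s \<epsilon> d1 p Lbig by (intro extremal_partition_strict) auto
      then show ?thesis using d1 by simp
    next
      case 3
      define b where "b = real t - real a"
      have b: "b \<ge> 1" "real t = real a + b" using 3 by (auto simp: b_def)
      have p: "real p = b + 1" using 3 by (simp add: p_def b_def)
      have deq: "d = real a * b" unfolding d_def N_def p b by (simp add: algebra_simps)
      have "real (\<delta> * t\<^sup>2 + \<delta>) \<le> real (n + 1)" using n(3) of_nat_le_iff by blast
      then have Lb: "L \<ge> (real s + b) * (real a + b)\<^sup>2 + (real s + b) - 3 - (real a + b)"
        unfolding L_def using \<delta>2 b s by (simp add: add.assoc)
      have s2: "real s \<ge> real a + 2" using s \<delta>2 by simp
      have a1: "real a \<ge> 1" using 3 by simp
      note few = excess_few_classes[OF a1 b(1) s2 Lb]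
      have "?T < (d + \<epsilon>) * (L + \<epsilon> + 1) / (real s + d + \<epsilon>)"
        unfolding deq using s \<epsilon> p a1 b few by (intro extremal_partition_strict) auto
      then show ?thesis using deq a1 b by simp
    next
      case 4
      have p: "real p = real t + 1" using 4 by (simp add: p_def)
      have deq: "d = 0" unfolding d_def N_def p using 4 by simp
      have "?T < (d + \<epsilon>) * (L + \<epsilon> + 1) / (real s + d + \<epsilon>)"
        unfolding deq p using excess_two_classes[of "2 * real k" "real t" \<epsilon> L] 4 \<epsilon> \<delta>2 Lbig s
        by simp
      then show ?thesis using deq by simp
    qed
  qed
  note val = extremal_partition_value[OF s(2) _ \<epsilon>(1) Ld, of "(real a + 1) * real p" "real p"]
  show "?v \<le> L + \<epsilon>" using val main by linarith
  show "?v < L + \<epsilon>" if "a \<noteq> t" using val main that by linarith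
  show "N < L + \<epsilon> + 1" using Ld main s \<epsilon> by linarith
qed

subsection \<open>Matchings and the extremal graph\<close>

lemma neighbors_subset: "neighbors G v \<subseteq> vertices G"
  by (auto simp: neighbors_def)

lemma neighbors_irrefl: "simple_graph G \<Longrightarrow> v \<notin> neighbors G v"
  by (auto simp: neighbors_def simple_graph_def)

lemma graph_degree_eq_card_neighbors:
  assumes "simple_graph G" "v \<in> vertices G"
  shows "graph_degree G v = card (neighbors G v)"
proof -
  have "bij_betw (\<lambda>u. {v, u}) (neighbors G v) {e \<in> edges G. v \<in> e}"
  proof (rule bij_betw_imageI)
    show "inj_on (\<lambda>u. {v, u}) (neighbors G v)" by (auto simp: inj_on_def doubleton_eq_iff)
    show "(\<lambda>u. {v, u}) ` neighbors G v = {e \<in> edges G. v \<in> e}"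
    proof (intro equalityI subsetI)
      fix e assume e: "e \<in> {e \<in> edges G. v \<in> e}"
      then have "card e = 2" "e \<subseteq> vertices G" using assms(1) by (auto simp: simple_graph_def)
      then obtain u where "e = {v, u}" using e by (auto simp: card_2_iff)
      then show "e \<in> (\<lambda>u. {v, u}) ` neighbors G v"
        using e \<open>e \<subseteq> vertices G\<close> by (auto simp: neighbors_def)
    qed (auto simp: neighbors_def)
  qed
  then show ?thesis unfolding graph_degree_def by (metis bij_betw_same_card)
qed

lemma min_degree_le_card_neighbors:
  assumes "simple_graph G" "v \<in> vertices G"
  shows "min_degree G \<le> card (neighbors G v)"
  unfolding min_degree_def graph_degree_eq_card_neighbors[OF assms, symmetric]
  using assms by (intro Min_le) (auto simp: simple_graph_def)

lemma card_Union_matching: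
  assumes "simple_graph G" "matching G M"
  shows "finite (\<Union>M)" "\<Union>M \<subseteq> vertices G" "card (\<Union>M) = 2 * card M"
proof -
  have e: "e \<subseteq> vertices G" "card e = 2" if "e \<in> M" for e
    using assms that by (auto simp: simple_graph_def matching_def)
  show sub: "\<Union>M \<subseteq> vertices G" using e by blast
  show "finite (\<Union>M)" using sub assms(1) by (meson finite_subset simple_graph_def)
  have "card (\<Union>M) = sum card M"
  proof (rule card_Union_disjoint)
    show "pairwise disjnt M" using assms(2) by (auto simp: pairwise_def disjnt_def matching_def)
    show "finite A" if "A \<in> M" for A using e[OF that] by (simp add: card_ge_0_finite)
  qed
  then show "card (\<Union>M) = 2 * card M" using e by simp
qed

text \<open>Greedy choice: fewer than \<open>k\<close> edges cover fewer than \<open>2 * k\<close>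
  vertices, so some vertex is uncovered, and so is one of its neighbors.\<close>

lemma ex_matching_of_card:
  assumes G: "simple_graph G" "vertices G \<noteq> {}"
    and deg: "\<And>v. v \<in> vertices G \<Longrightarrow> 2 * k \<le> card (neighbors G v)"
  shows "\<exists>M. matching G M \<and> card M = k"
proof -
  have fin: "finite (vertices G)" using G by (simp add: simple_graph_def)
  have "\<exists>M. matching G M \<and> finite M \<and> card M = j" if "j \<le> k" for j
    using that
  proof (induction j)
    case 0
    have "matching G {}" by (simp add: matching_def)
    then show ?case by (intro exI[of _ "{}"]) simp
  next
    case (Suc j)
    then obtain M where M: "matching G M" "finite M" "card M = j" by auto
    note U = card_Union_matching[OF G(1) M(1)]
    obtain v0 where v0: "v0 \<in> vertices G" using G by auto
    have "2 * k \<le> card (neighbors G v0)" by (rule deg[OF v0])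
    also have "\<dots> \<le> card (vertices G)" by (rule card_mono[OF fin neighbors_subset])
    finally have "card (\<Union>M) < card (vertices G)" using U M Suc.prems by simp
    then have "\<not> vertices G \<subseteq> \<Union>M" using card_mono[OF U(1), of "vertices G"] by (meson not_le)
    then obtain v where v: "v \<in> vertices G" "v \<notin> \<Union>M" by blast
    have "card (\<Union>M) < card (neighbors G v)" using deg[OF v(1)] U M Suc.prems by simp
    then have "\<not> neighbors G v \<subseteq> \<Union>M" using card_mono[OF U(1), of "neighbors G v"] by (meson not_le)
    then obtain u where u: "u \<in> neighbors G v" "u \<notin> \<Union>M" by blast
    have "matching G (insert {v, u} M)"
      using M(1) u v unfolding matching_def neighbors_def by auto
    moreover have "{v, u} \<notin> M" using v by auto
    ultimately show ?case using M by (intro exI[of _ "insert {v, u} M"]) auto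
  qed
  then show ?thesis by blast
qed

text \<open>Apply \<open>weak_Tutte\<close> to the vertices not covered by \<open>M\<close> and add
  the \<open>2 * k\<close> covered ones to the separator; \<open>a\<close> is the size of the
  separator found there.\<close>

lemma nonextendable_matching_separator:
  assumes G: "simple_graph G" "even (card (vertices G))"
    and M: "matching G M" "card M = k"
    and no: "\<nexists>P. perfect_matching G P \<and> M \<subseteq> P"
  obtains S and color :: "'a \<Rightarrow> 'a set" and a where "S \<subseteq> vertices G" "card S = 2 * k + a"
    "a + 2 \<le> card (color ` (vertices G - S))"
    "\<And>u v. u \<in> vertices G - S \<Longrightarrow> v \<in> vertices G - S \<Longrightarrow> {u, v} \<in> edges G \<Longrightarrow> color u = color v"
proof -
  let ?V = "vertices G - \<Union>M"
  define E where "E u v \<longleftrightarrow> {u, v} \<in> edges G" for u v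
  note U = card_Union_matching[OF G(1) M(1)]
  have fin: "finite (vertices G)" using G by (simp add: simple_graph_def)
  have cV: "card ?V = card (vertices G) - 2 * k" using U M by (simp add: card_Diff_subset)
  have "2 * k \<le> card (vertices G)" using card_mono[OF fin U(2)] U(3) M by simp
  then have ev: "even (card ?V)" using cV G(2) by simp
  have none: "\<nexists>f. pm_involution ?V E f"
  proof
    assume "\<exists>f. pm_involution ?V E f"
    then obtain f where f: "\<And>v. v \<in> ?V \<Longrightarrow> f v \<in> ?V \<and> f (f v) = v \<and> {v, f v} \<in> edges G"
      unfolding pm_involution_def E_def by blast
    define F where "F = (\<lambda>v. {v, f v}) ` ?V"
    have FV: "e \<subseteq> ?V" if "e \<in> F" for e using that f unfolding F_def by blast
    have disj: "e \<inter> e' = {}" if ne: "e \<noteq> e'" and F: "e \<in> F" "e' \<in> F" for e e'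
    proof -
      obtain u v where uv: "u \<in> ?V" "v \<in> ?V" "e = {u, f u}" "e' = {v, f v}"
        using F unfolding F_def by blast
      show ?thesis
      proof (rule ccontr)
        assume "e \<inter> e' \<noteq> {}"
        then have "u = v \<or> u = f v \<or> f u = v \<or> f u = f v" using uv by auto
        moreover have ff: "f (f u) = u" "f (f v) = v" using f uv by auto
        ultimately have "u = v \<or> f u = v" by metis
        then have "e = e'" using uv(3,4) ff by auto
        then show False using ne by simp
      qed
    qed
    have "matching G (M \<union> F)"
      unfolding matching_def
    proof (intro conjI ballI impI)
      show "M \<union> F \<subseteq> edges G" using M f unfolding matching_def F_def by auto
      have MF: "e \<inter> e' = {}" if "e \<in> M" "e' \<in> F" for e e' using FV[OF that(2)] that(1) by blast
      have MM: "e \<inter> e' = {}" if "e \<in> M" "e' \<in> M" "e \<noteq> e'" for e e'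
        using M(1) that unfolding matching_def by simp
      fix e e' assume "e \<in> M \<union> F" "e' \<in> M \<union> F" "e \<noteq> e'"
      then show "e \<inter> e' = {}" using MM[of e e'] MF[of e e'] MF[of e' e] disj[of e e'] by (auto simp: Int_commute)
    qed
    moreover have "\<Union>(M \<union> F) = vertices G"
    proof
      show "\<Union>(M \<union> F) \<subseteq> vertices G" using U(2) FV by blast
      show "vertices G \<subseteq> \<Union>(M \<union> F)" unfolding F_def by blast
    qed
    ultimately show False using no unfolding perfect_matching_def by blast
  qed
  have sym: "E u v \<Longrightarrow> E v u" for u v by (simp add: E_def insert_commute)
  have irr: "\<not> E u u" for u using G(1) by (auto simp: E_def simple_graph_def)
  obtain S and color :: "'a \<Rightarrow> 'a set" where S: "S \<subseteq> ?V" "card S + 2 \<le> card (color ` (?V - S))"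
    "\<And>u v. u \<in> ?V - S \<Longrightarrow> v \<in> ?V - S \<Longrightarrow> E u v \<Longrightarrow> color u = color v"
    using weak_Tutte[OF _ ev sym irr none] fin by (metis finite_Diff)
  have eq: "vertices G - (S \<union> \<Union>M) = ?V - S" by blast
  have finS: "finite S" using S fin by (meson finite_Diff finite_subset)
  have "card (S \<union> \<Union>M) = card S + card (\<Union>M)"
    using S U finS by (intro card_Un_disjoint) auto
  then show ?thesis
    using that[of "S \<union> \<Union>M" "card S" color] S U M eq unfolding E_def by auto
qed

section \<open>Structure and eigenvalue of the extremal graph\<close>

lemma edges_complete_graph_iff:
  "{a, b} \<in> edges (complete_graph m) \<longleftrightarrow> a < m \<and> b < m \<and> a \<noteq> b"
  by (auto simp: complete_graph_def doubleton_eq_iff)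

lemma image_Inl_doubleton_iff: "{Inl a, Inl b} = Inl ` e \<longleftrightarrow> {a, b} = e"
  using inj_image_eq_iff[of Inl "{a, b}" e] by simp

lemma image_Inr_doubleton_iff: "{Inr a, Inr b} = Inr ` e \<longleftrightarrow> {a, b} = e"
  using inj_image_eq_iff[of Inr "{a, b}" e] by simp

lemma edges_disjoint_union_iff:
  "{Inl a, Inl b} \<in> edges (disjoint_union G H) \<longleftrightarrow> {a, b} \<in> edges G"
  "{Inr c, Inr d} \<in> edges (disjoint_union G H) \<longleftrightarrow> {c, d} \<in> edges H"
  "{Inl a, Inr d} \<notin> edges (disjoint_union G H)"
  "{Inr d, Inl a} \<notin> edges (disjoint_union G H)"
  unfolding disjoint_union_def
  by (auto simp: image_iff image_Inl_doubleton_iff image_Inr_doubleton_iff)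

lemma edges_graph_join_iff:
  "{Inl a, Inl b} \<in> edges (graph_join G H) \<longleftrightarrow> {a, b} \<in> edges G"
  "{Inr c, Inr d} \<in> edges (graph_join G H) \<longleftrightarrow> {c, d} \<in> edges H"
  "{Inl a, Inr d} \<in> edges (graph_join G H) \<longleftrightarrow> a \<in> vertices G \<and> d \<in> vertices H"
  "{Inr d, Inl a} \<in> edges (graph_join G H) \<longleftrightarrow> a \<in> vertices G \<and> d \<in> vertices H"
  unfolding graph_join_def
  by (auto simp: edges_disjoint_union_iff doubleton_eq_iff)

lemma edges_graph_copies_K1: "edges (graph_copies r (complete_graph 1)) = {}"
  by (auto simp: graph_copies_def complete_graph_def)

lemma vertices_extremal_graph:
  "vertices (extremal_graph k \<delta> n) = Inl ` {0..<\<delta>} \<union>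
    (Inr \<circ> Inl) ` {0..<n + 2 * k - (2 * \<delta> + 1)} \<union> (\<lambda>i. Inr (Inr (i, 0))) ` {0..<\<delta> - 2 * k + 1}"
  by (auto simp: extremal_graph_def graph_join_def disjoint_union_def graph_copies_def
      complete_graph_def image_iff)

lemma extremal_graph_vertex_cases:
  assumes "v \<in> vertices (extremal_graph k \<delta> n)"
  obtains i where "v = Inl i" "i < \<delta>"
  | j where "v = Inr (Inl j)" "j < n + 2 * k - (2 * \<delta> + 1)"
  | i where "v = Inr (Inr (i, 0))" "i < \<delta> - 2 * k + 1"
  using assms unfolding vertices_extremal_graph by fastforce

text \<open>\<open>isl\<close> recognizes the dominating clique, and \<open>isl (projr u)\<close>
  the other clique. The values of \<open>projr\<close> matter only when both vertices are of the
  form \<open>Inr\<close>.\<close>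

lemma edges_extremal_graph_iff:
  assumes u: "u \<in> vertices (extremal_graph k \<delta> n)" and v: "v \<in> vertices (extremal_graph k \<delta> n)"
  shows "{u, v} \<in> edges (extremal_graph k \<delta> n) \<longleftrightarrow>
    u \<noteq> v \<and> (isl u \<or> isl v \<or> (isl (projr u) \<and> isl (projr v)))"
proof -
  have cv: "a \<in> vertices (complete_graph m) \<longleftrightarrow> a < m" for a m :: nat by (simp add: complete_graph_def)
  have dl: "Inl a \<in> vertices (disjoint_union G H) \<longleftrightarrow> a \<in> vertices G" for a and G :: "'b ugraph" and H :: "'c ugraph"
    by (auto simp: disjoint_union_def)
  have dr: "Inr a \<in> vertices (disjoint_union G H) \<longleftrightarrow> a \<in> vertices H" for a and G :: "'b ugraph" and H :: "'c ugraph"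
    by (auto simp: disjoint_union_def)
  have gc: "(i, a) \<in> vertices (graph_copies r (complete_graph 1)) \<longleftrightarrow> i < r \<and> a = 0" for i r a
    by (auto simp: graph_copies_def complete_graph_def)
  note simps = extremal_graph_def edges_graph_join_iff edges_disjoint_union_iff edges_complete_graph_iff
    edges_graph_copies_K1 cv dl dr gc
  show ?thesis
    by (rule extremal_graph_vertex_cases[OF u]; rule extremal_graph_vertex_cases[OF v]; simp add: simps del: One_nat_def)
qed

text \<open>The eigenvector is constant on the three parts, with the weights
  \<open>s / (\<theta> + 1 - x)\<close> for \<open>s = \<delta>\<close> and class sizes
  \<open>x = ?m\<close> and \<open>x = 1\<close>. The equation for \<open>\<epsilon>\<close> is the
  condition at the dominating vertices.\<close>

lemma extremal_graph_eigenvalue: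
  fixes k t \<delta> n :: nat and \<epsilon> L :: real
  assumes \<delta>: "\<delta> = 2 * k + t" "\<delta> > 0" and n: "2 * \<delta> < n + 2 * k" and L: "L = real n - real t - 2"
    and "\<epsilon> > 0" "L + \<epsilon> > 0"
    and eq: "\<epsilon> * (L + \<epsilon> + 1) * (L + \<epsilon>) = (real t + 1) * real \<delta> * (real \<delta> + \<epsilon>)"
  shows "eigenvalue (adjacency_matrix (extremal_graph k \<delta> n)) (L + \<epsilon>)"
proof -
  let ?H = "extremal_graph k \<delta> n" and ?\<theta> = "L + \<epsilon>"
  let ?m = "n + 2 * k - (2 * \<delta> + 1)" and ?r = "\<delta> - 2 * k + 1"
  let ?A = "Inl ` {0..<\<delta>} :: (nat + (nat + nat \<times> nat)) set"
    and ?B = "(Inr \<circ> Inl) ` {0..<?m} :: (nat + (nat + nat \<times> nat)) set"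
    and ?C = "(\<lambda>i. Inr (Inr (i, 0))) ` {0..<?r} :: (nat + (nat + nat \<times> nat)) set"
  have V: "vertices ?H = ?A \<union> ?B \<union> ?C" by (rule vertices_extremal_graph)
  have fin: "finite (vertices ?H)" unfolding V by simp
  have m: "real ?m = L + 1 - real \<delta>" using n \<delta> L by (simp add: of_nat_diff)
  have cA: "card ?A = \<delta>" and cB: "card ?B = ?m" and cC: "card ?C = ?r"
    by (simp_all add: card_image inj_on_def)
  have r: "real ?r = real t + 1" using \<delta> by simp
  define x :: "nat + (nat + nat \<times> nat) \<Rightarrow> real" where
    "x v = (if v \<in> ?A then 1 else if v \<in> ?B then \<delta> / (\<delta> + \<epsilon>) else \<delta> / ?\<theta>)" for v
  have disj: "?A \<inter> ?B = {}" "?A \<inter> ?C = {}" "?B \<inter> ?C = {}" by auto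
  have sA: "sum x ?A = real \<delta>" unfolding x_def using cA by simp
  have sB: "sum x ?B = real ?m * (\<delta> / (\<delta> + \<epsilon>))"
  proof -
    have "sum x ?B = (\<Sum>v\<in>?B. \<delta> / (\<delta> + \<epsilon>))" using disj by (intro sum.cong refl) (auto simp: x_def)
    then show ?thesis using cB by simp
  qed
  have sC: "sum x ?C = real ?r * (\<delta> / ?\<theta>)"
  proof -
    have "sum x ?C = (\<Sum>v\<in>?C. \<delta> / ?\<theta>)" using disj by (intro sum.cong refl) (auto simp: x_def)
    then show ?thesis using cC by simp
  qed
  have d\<epsilon>: "real \<delta> + \<epsilon> > 0" using assms by simp
  have "sum x (neighbors ?H v) = ?\<theta> * x v" if v: "v \<in> vertices ?H" for v
  proof -
    have nb: "neighbors ?H v =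
      {u \<in> vertices ?H. v \<noteq> u \<and> (isl v \<or> isl u \<or> (isl (projr v) \<and> isl (projr u)))}"
      using edges_extremal_graph_iff[OF v] by (auto simp: neighbors_def)
    consider "v \<in> ?A" | "v \<in> ?B" | "v \<in> ?C" using v unfolding V by blast
    then show ?thesis
    proof cases
      case 1
      then have "neighbors ?H v = vertices ?H - {v}"
        unfolding nb by auto
      then have "sum x (neighbors ?H v) = sum x (vertices ?H) - x v"
        using fin v by (simp add: sum_diff1)
      also have "sum x (vertices ?H) = sum x ?A + sum x ?B + sum x ?C"
        unfolding V using disj by (subst sum.union_disjoint; (subst sum.union_disjoint)?) auto
      also have "x v = 1" using 1 by (simp add: x_def)
      also have "sum x ?A + sum x ?B + sum x ?C - 1 = ?\<theta>"
      proof -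
        have e: "(L + 1 - real \<delta>) * (\<delta> / (\<delta> + \<epsilon>)) = L + 1 - real \<delta> - (L + 1 - real \<delta>) * \<epsilon> / (\<delta> + \<epsilon>)"
          using d\<epsilon> by (simp add: field_simps)
        have "(real t + 1) * (\<delta> / ?\<theta>) = \<epsilon> * (L + \<epsilon> + 1) / (\<delta> + \<epsilon>)"
          using eq d\<epsilon> assms(6) by (simp add: frac_eq_eq mult_ac)
        also have "\<dots> = \<epsilon> + (L + 1 - real \<delta>) * \<epsilon> / (\<delta> + \<epsilon>)"
          using d\<epsilon> by (simp add: field_simps)
        finally show ?thesis unfolding sA sB sC m r e by simp
      qed
      finally show ?thesis using 1 by (simp add: x_def)
    next
      case 2
      then have "neighbors ?H v = ?A \<union> (?B - {v})"
        unfolding nb V by auto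
      then have "sum x (neighbors ?H v) = sum x ?A + (sum x ?B - x v)"
        using 2 disj sum.union_disjoint[of ?A "?B - {v}" x] by (simp add: Diff_Int_distrib sum_diff1)
      also have "x v = \<delta> / (\<delta> + \<epsilon>)" using 2 disj by (auto simp: x_def)
      also have "sum x ?A + (sum x ?B - \<delta> / (\<delta> + \<epsilon>)) = ?\<theta> * (\<delta> / (\<delta> + \<epsilon>))"
      proof -
        have "real \<delta> + ((L + 1 - real \<delta>) * X - X) = ?\<theta> * X" if "(real \<delta> + \<epsilon>) * X = real \<delta>" for X
          using that by (simp add: algebra_simps)
        from this[of "\<delta> / (\<delta> + \<epsilon>)"] show ?thesis unfolding sA sB m using d\<epsilon> by simp
      qed
      finally show ?thesis using 2 disj by (auto simp: x_def)
    next
      case 3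
      then have "neighbors ?H v = ?A"
        unfolding nb V by auto
      then have "sum x (neighbors ?H v) = real \<delta>" using sA by simp
      moreover have "x v = \<delta> / ?\<theta>" using 3 disj by (auto simp: x_def)
      ultimately show ?thesis using assms(6) by simp
    qed
  qed
  moreover have "Inl 0 \<in> vertices ?H" "x (Inl 0) \<noteq> 0" using \<delta> unfolding V x_def by auto
  ultimately show ?thesis using eigenvalue_adjacency_matrix_iff[OF fin] by blast
qed

text \<open>Adjacency of distinct vertices depends only on their parts, so any enumerations of
  \<open>S\<close>, \<open>C\<close> and the rest combine to an isomorphism.\<close>

lemma graph_iso_extremal_graph:
  assumes fin: "finite (vertices G)" and S: "S \<subseteq> vertices G" and C: "C \<subseteq> vertices G - S"
    and card: "card S = \<delta>" "card C = n + 2 * k - (2 * \<delta> + 1)"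
      "card (vertices G - S - C) = \<delta> - 2 * k + 1"
    and edges: "\<And>u v. u \<in> vertices G \<Longrightarrow> v \<in> vertices G \<Longrightarrow>
      {u, v} \<in> edges G \<longleftrightarrow> u \<noteq> v \<and> (u \<in> S \<or> v \<in> S \<or> (u \<in> C \<and> v \<in> C))"
  shows "graph_iso G (extremal_graph k \<delta> n)"
proof -
  let ?D = "vertices G - S - C" and ?H = "extremal_graph k \<delta> n"
  have fins: "finite S" "finite C" "finite ?D" using fin S C by (auto intro: finite_subset)
  obtain f where f: "bij_betw f S {0..<\<delta>}" using ex_bij_betw_finite_nat[OF fins(1)] card by blast
  obtain g where g: "bij_betw g C {0..<n + 2 * k - (2 * \<delta> + 1)}"
    using ex_bij_betw_finite_nat[OF fins(2)] card by metis
  obtain h where h: "bij_betw h ?D {0..<\<delta> - 2 * k + 1}"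
    using ex_bij_betw_finite_nat[OF fins(3)] card by metis
  define \<phi> :: "'a \<Rightarrow> nat + (nat + nat \<times> nat)" where
    "\<phi> v = (if v \<in> S then Inl (f v) else if v \<in> C then Inr (Inl (g v)) else Inr (Inr (h v, 0)))" for v
  have "\<phi> ` vertices G = \<phi> ` S \<union> \<phi> ` C \<union> \<phi> ` ?D" using S C by blast
  also have "\<phi> ` S = Inl ` f ` S" by (auto simp: \<phi>_def)
  also have "\<phi> ` C = (Inr \<circ> Inl) ` g ` C" using C by (force simp: \<phi>_def)
  also have "\<phi> ` ?D = (\<lambda>i. Inr (Inr (i, 0))) ` h ` ?D" by (force simp: \<phi>_def)
  finally have im: "\<phi> ` vertices G = vertices ?H"
    unfolding vertices_extremal_graph using f g h by (simp add: bij_betw_def)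
  have inj: "inj_on \<phi> (vertices G)"
  proof (rule inj_onI)
    fix u v assume "u \<in> vertices G" "v \<in> vertices G" "\<phi> u = \<phi> v"
    then show "u = v" using f g h unfolding \<phi>_def bij_betw_def inj_on_def
      by (auto split: if_splits)
  qed
  have "{u, v} \<in> edges G \<longleftrightarrow> {\<phi> u, \<phi> v} \<in> edges ?H" if uv: "u \<in> vertices G" "v \<in> vertices G" for u v
  proof -
    have "\<phi> u \<in> vertices ?H" "\<phi> v \<in> vertices ?H" using uv im by auto
    moreover have "isl (\<phi> w) \<longleftrightarrow> w \<in> S" for w by (simp add: \<phi>_def)
    moreover have "isl (projr (\<phi> w)) \<longleftrightarrow> w \<in> C" if "w \<notin> S" for w using that by (simp add: \<phi>_def)
    moreover have "\<phi> u = \<phi> v \<longleftrightarrow> u = v" using inj uv by (auto dest: inj_onD)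
    ultimately show ?thesis using edges[OF uv] edges_extremal_graph_iff[of "\<phi> u" k \<delta> n "\<phi> v"] by auto
  qed
  then show ?thesis unfolding graph_iso_def bij_betw_def using im inj by blast
qed

subsection \<open>Nonextendable matchings force the extremal graph\<close>

lemma sum_pos_subset_eq:
  fixes f :: "'a \<Rightarrow> real"
  assumes "finite B" "A \<subseteq> B" "\<And>x. x \<in> B \<Longrightarrow> f x > 0" "sum f B \<le> sum f A"
  shows "A = B"
proof (rule ccontr)
  assume "A \<noteq> B"
  then obtain b where b: "b \<in> B - A" using assms(2) by blast
  have "sum f A < sum f B"
    by (rule sum_strict_mono2[OF assms(1,2) b]) (use assms(3) b in \<open>auto intro: less_imp_le\<close>)
  then show False using assms(4) by simp
qed

text \<open>The weights \<open>z\<close> form a supersolution for \<open>L + \<epsilon>\<close>, so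
  by \<open>\<rho>\<close> no inequality along the way can be strict. The equalities then determine
  the neighborhoods, the value of \<open>a\<close> and the class sizes.\<close>

lemma separator_imp_graph_iso_extremal_graph:
  fixes G :: "'a ugraph" and k t \<delta> n a :: nat and \<epsilon> L :: real and color :: "'a \<Rightarrow> 'b"
  assumes G: "simple_graph G" "graph_connected G" "card (vertices G) = n"
    and deg: "\<And>v. v \<in> vertices G \<Longrightarrow> \<delta> \<le> card (neighbors G v)"
    and k: "k \<ge> 1" and \<delta>: "\<delta> = 2 * k + t"
    and n: "even n" "3 * \<delta> + 5 * t + 4 \<le> n" "\<delta> * t\<^sup>2 + \<delta> \<le> n + 1"
    and L: "L = real n - real t - 2"
    and \<epsilon>: "\<epsilon> > 0" "\<epsilon> * (L + \<epsilon> + 1) * (L + \<epsilon>) = (real t + 1) * real \<delta> * (real \<delta> + \<epsilon>)"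
    and \<rho>: "L + \<epsilon> \<le> graph_spectral_radius G"
    and S: "S \<subseteq> vertices G" "card S = 2 * k + a" "a + 2 \<le> card (color ` (vertices G - S))"
    and mono: "\<And>u v. u \<in> vertices G - S \<Longrightarrow> v \<in> vertices G - S \<Longrightarrow> {u, v} \<in> edges G \<Longrightarrow> color u = color v"
  shows "graph_iso G (extremal_graph k \<delta> n)"
proof -
  let ?V = "vertices G"
  define W where "W = ?V - S"
  define cl where "cl v = {u \<in> W. color u = color v}" for v
  define s where "s = 2 * k + a"
  define p where "p = (if t \<le> a then 1 else t - a + 1)"
  define N where "N = real n - real s - (real a + 1) * real p"
  define c where "c = L + \<epsilon> + 1"
  have fin: "finite ?V" using G by (simp add: simple_graph_def)
  have finS: "finite S" using fin S finite_subset by blast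
  have finW: "finite W" using fin by (simp add: W_def)
  have fincl: "finite (cl v)" for v using finW by (simp add: cl_def)
  have clW: "cl v \<subseteq> W" for v by (auto simp: cl_def)
  have cS: "card S = s" using S by (simp add: s_def)
  have cW: "card W + s = n"
    using card_mono[OF fin S(1)] G(3) cS finS S(1) by (simp add: W_def card_Diff_subset)
  have nbW: "neighbors G v \<subseteq> S \<union> (cl v - {v})" if "v \<in> W" for v
    using that mono[of v] neighbors_irrefl[OF G(1), of v] unfolding W_def cl_def neighbors_def by auto
  have vcl: "v \<in> cl v" if "v \<in> W" for v using that by (simp add: cl_def)
  have card_cl: "card (cl v - {v}) = card (cl v) - 1" "card (cl v) \<ge> 1" if "v \<in> W" for v
    using vcl[OF that] fincl[of v] by (auto simp: Suc_le_eq card_gt_0_iff)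
  have disjS: "S \<inter> (cl v - {v}) = {}" for v by (auto simp: cl_def W_def)
  \<comment> \<open>A vertex of \<open>W\<close> has neighbors only in \<open>S\<close> and its own
    class, so the minimum degree bounds the class size from below.\<close>
  have lower: "p \<le> card (cl v)" if v: "v \<in> W" for v
  proof -
    have "\<delta> \<le> card (neighbors G v)" using deg v by (simp add: W_def)
    also have "\<dots> \<le> card (S \<union> (cl v - {v}))" using nbW[OF v] finS fincl by (intro card_mono) auto
    also have "\<dots> = s + (card (cl v) - 1)"
      using card_Un_disjoint[OF finS _ disjS, of v] fincl[of v] cS card_cl[OF v] by simp
    finally show ?thesis using card_cl(2)[OF v] \<delta> unfolding p_def s_def by auto
  qed
  have total: "real (card W) = (real a + 1) * real p + N"
    using cW unfolding N_def by linarith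
  have classes: "a + 2 \<le> card (color ` W)" using S(3) by (simp add: W_def)
  have p0: "real p > 0" by (simp add: p_def)
  have lower': "real p \<le> real (card {u \<in> W. color u = color v})" if "v \<in> W" for v
    using lower[OF that] by (simp add: cl_def)
  have upper: "real (card (cl v)) \<le> N" if "v \<in> W" for v
    using color_class_size_le[OF finW p0 lower' total classes that] by (simp add: cl_def)
  have "W \<noteq> {}" using classes by auto
  then have pN: "real p \<le> N" using lower upper by (metis all_not_in_conv of_nat_mono order_trans)
  note bound = separator_value_bound[OF k \<delta> n, of \<epsilon> a, folded L s_def p_def, folded N_def, OF \<epsilon> pN, folded c_def]
  note sums = color_class_sum_bound[OF finW p0 bound(3) lower' total classes]
  \<comment> \<open>The weight on a class of size \<open>x\<close> solves
    \<open>s + (x - 1) * z = (L + \<epsilon>) * z\<close>, the eigenvalue equation when the class is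
    a clique joined to all of \<open>S\<close>.\<close>
  define z where "z v = (if v \<in> S then 1 else real s / (c - real (card (cl v))))" for v
  have s0: "real s > 0" using k by (simp add: s_def)
  have cpos: "c - real (card (cl v)) > 0" if "v \<in> W" for v using upper[OF that] bound(3) by linarith
  have zpos: "z v > 0" if "v \<in> ?V" for v
    using that cpos[of v] s0 by (auto simp: z_def W_def)
  have zS: "sum z S = real s" using cS by (simp add: z_def)
  have zW: "sum z W = real s * (\<Sum>v\<in>W. 1 / (c - real (card {u \<in> W. color u = color v})))"
    unfolding sum_distrib_left by (intro sum.cong refl) (auto simp: z_def W_def cl_def)
  have zV: "sum z (?V - {u}) = real s - 1 + sum z W" if "u \<in> S" for u
  proof -
    have "sum z ?V = sum z S + sum z W"
      unfolding W_def using fin S(1) by (metis add.commute sum.subset_diff)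
    then show ?thesis using that S(1) fin zS by (auto simp: sum_diff1 z_def)
  qed
  have WB: "real s - 1 + sum z W \<le>
    real s * ((real a + 1) * real p / (c - real p) + N / (c - N)) + real s - 1"
    unfolding zW using mult_left_mono[OF sums(1), of "real s"] s0 by simp
  have zcl: "sum z (S \<union> (cl v - {v})) = (L + \<epsilon>) * z v" if v: "v \<in> W" for v
  proof -
    let ?x = "real (card (cl v))"
    have zc: "z u = real s / (c - ?x)" if "u \<in> cl v" for u
      using that by (auto simp: z_def cl_def W_def)
    have "sum z (S \<union> (cl v - {v})) = sum z S + sum z (cl v - {v})"
      using finS fincl disjS by (intro sum.union_disjoint) auto
    also have "sum z (cl v - {v}) = (?x - 1) * (real s / (c - ?x))"
      using zc card_cl[OF v] by (simp add: of_nat_diff)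
    also have "sum z S + (?x - 1) * (real s / (c - ?x)) = (L + \<epsilon>) * (real s / (c - ?x))"
      unfolding zS using cpos[OF v] by (simp add: field_simps c_def)
    also have "real s / (c - ?x) = z v" using zc[OF vcl[OF v]] by simp
    finally show ?thesis .
  qed
  have nbS: "neighbors G u \<subseteq> ?V - {u}" for u
    using neighbors_subset[of G u] neighbors_irrefl[OF G(1), of u] by blast
  have leS: "sum z (neighbors G u) \<le> real s - 1 + sum z W" if "u \<in> S" for u
    unfolding zV[OF that, symmetric] using nbS fin zpos by (intro sum_mono2) (auto intro: less_imp_le)
  have leW: "sum z (neighbors G v) \<le> sum z (S \<union> (cl v - {v}))" if "v \<in> W" for v
    using nbW[OF that] finS fincl zpos S(1) clW
    by (intro sum_mono2) (auto intro!: less_imp_le simp: W_def cl_def)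
  have super: "sum z (neighbors G v) \<le> (L + \<epsilon>) * z v" if "v \<in> ?V" for v
  proof (cases "v \<in> S")
    case True
    then have "(L + \<epsilon>) * z v = L + \<epsilon>" by (simp add: z_def)
    then show ?thesis using leS[OF True] WB bound(1) by linarith
  next
    case False
    then have "v \<in> W" using that by (simp add: W_def)
    then show ?thesis using leW zcl by simp
  qed
  have eq: "sum z (neighbors G v) = (L + \<epsilon>) * z v" if "v \<in> ?V" for v
  proof (rule ccontr)
    assume "sum z (neighbors G v) \<noteq> (L + \<epsilon>) * z v"
    then have "sum z (neighbors G v) < (L + \<epsilon>) * z v" using super[OF that] by simp
    then have "graph_spectral_radius G < L + \<epsilon>"
      using graph_spectral_radius_less[OF G(1,2) zpos super that] by blast
    then show False using \<rho> by simp
  qed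
  have eqS: "L + \<epsilon> = sum z (neighbors G u)" if "u \<in> S" for u
    using eq[of u] that S(1) by (auto simp: z_def)
  have fullS: "neighbors G u = ?V - {u}" if u: "u \<in> S" for u
  proof (rule sum_pos_subset_eq[OF _ nbS])
    show "sum z (?V - {u}) \<le> sum z (neighbors G u)"
      using zV[OF u] WB bound(1) eqS[OF u] by linarith
  qed (use fin zpos in auto)
  have fullW: "neighbors G v = S \<union> (cl v - {v})" if v: "v \<in> W" for v
  proof (rule sum_pos_subset_eq[OF _ nbW[OF v]])
    show "sum z (S \<union> (cl v - {v})) \<le> sum z (neighbors G v)"
      using zcl[OF v] eq[of v] v by (simp add: W_def)
  qed (use finS fincl zpos S(1) clW in \<open>auto simp: W_def cl_def\<close>)
  have "S \<noteq> {}" using cS s0 by auto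
  then obtain u0 where u0: "u0 \<in> S" by blast
  have at: "a = t"
  proof (rule ccontr)
    assume "a \<noteq> t"
    from bound(2)[OF this] show False using leS[OF u0] eqS[OF u0] WB by linarith
  qed
  have p1: "p = 1" using at by (simp add: p_def)
  have s\<delta>: "s = \<delta>" using at \<delta> by (simp add: s_def)
  have "real s * (\<Sum>v\<in>W. 1 / (c - real (card {u \<in> W. color u = color v}))) =
    real s * ((real a + 1) * real p / (c - real p) + N / (c - N))"
    using leS[OF u0] eqS[OF u0] WB bound(1) unfolding zW by linarith
  then have shape: "card (color ` W) = a + 2" "\<And>v. v \<in> W \<Longrightarrow> real (card (cl v)) = 1 \<or> real (card (cl v)) = N"
    using sums(2) s0 p1 by (auto simp: cl_def)
  have cWt: "card W = n - \<delta>" using cW s\<delta> by simp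
  have Nm: "N = real (n + 2 * k - (2 * \<delta> + 1))"
    unfolding N_def p1 s\<delta> at using n(2) \<delta> by (simp add: of_nat_diff)
  \<comment> \<open>Otherwise all classes are singletons and \<open>W\<close> has only
    \<open>a + 2\<close> vertices, too few for the order \<open>n\<close>.\<close>
  have "\<exists>v\<in>W. real (card (cl v)) = N"
  proof (rule ccontr)
    assume "\<not> ?thesis"
    then have one: "card (cl v) = 1" if "v \<in> W" for v using shape(2)[OF that] that by auto
    have "inj_on color W"
    proof (rule inj_onI)
      fix u v assume uv: "u \<in> W" "v \<in> W" "color u = color v"
      then have "u \<in> cl v" "v \<in> cl v" by (auto simp: cl_def)
      then show "u = v" using one[OF uv(2)] by (metis card_1_singletonE singletonD)
    qed
    then have "card W = a + 2" using shape(1) card_image by metis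
    then show False using cWt n(2) at \<delta> k by simp
  qed
  then obtain v0 where v0: "v0 \<in> W" "real (card (cl v0)) = N" by blast
  define C where "C = cl v0"
  have CW: "C \<subseteq> W" by (simp add: C_def clW)
  have cC: "card C = n + 2 * k - (2 * \<delta> + 1)" using v0(2) Nm by (simp add: C_def)
  have cD: "card (W - C) = t + 1"
    using cWt cC n(2) \<delta> CW finite_subset[OF CW finW] by (simp add: card_Diff_subset)
  \<comment> \<open>Outside \<open>C\<close> there remain \<open>t + 1\<close> vertices and, since
    \<open>a = t\<close>, as many colors; hence these vertices are pairwise nonadjacent.\<close>
  have "color ` (W - C) = color ` W - {color v0}" using v0(1) by (auto simp: C_def cl_def)
  then have "card (color ` (W - C)) = card (W - C)"
    using shape(1) v0(1) finW at cD by simp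
  then have injD: "inj_on color (W - C)" using finW by (simp add: eq_card_imp_inj_on)
  show ?thesis
  proof (rule graph_iso_extremal_graph[OF fin S(1), of C])
    show "C \<subseteq> ?V - S" using CW by (simp add: W_def)
    show "card S = \<delta>" using cS s\<delta> by simp
    show "card C = n + 2 * k - (2 * \<delta> + 1)" by (rule cC)
    show "card (?V - S - C) = \<delta> - 2 * k + 1" using cD \<delta> by (simp add: W_def)
    fix u v assume uv: "u \<in> ?V" "v \<in> ?V"
    have e: "{u, v} \<in> edges G \<longleftrightarrow> v \<in> neighbors G u" "{u, v} \<in> edges G \<longleftrightarrow> u \<in> neighbors G v"
      using uv by (auto simp: neighbors_def insert_commute)
    show "{u, v} \<in> edges G \<longleftrightarrow> u \<noteq> v \<and> (u \<in> S \<or> v \<in> S \<or> (u \<in> C \<and> v \<in> C))"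
    proof (cases "u \<in> S \<or> v \<in> S")
      case True
      then show ?thesis
      proof
        assume "u \<in> S"
        then show ?thesis using e(1) fullS uv by auto
      next
        assume "v \<in> S"
        then show ?thesis using e(2) fullS uv by auto
      qed
    next
      case False
      then have W: "u \<in> W" "v \<in> W" using uv by (auto simp: W_def)
      have "{u, v} \<in> edges G \<longleftrightarrow> u \<noteq> v \<and> color u = color v"
        unfolding e(1) fullW[OF W(1)] cl_def using W(2) False by (auto simp only: Un_iff Diff_iff mem_Collect_eq)
      also have "\<dots> \<longleftrightarrow> u \<noteq> v \<and> u \<in> C \<and> v \<in> C"
      proof -
        have "u = v" if c: "color u = color v" and nC: "\<not> (u \<in> C \<and> v \<in> C)"
        proof -
          have "u \<notin> C" "v \<notin> C" using c nC W by (auto simp: C_def cl_def)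
          then show ?thesis using inj_onD[OF injD c] W by blast
        qed
        moreover have "color u = color v" if "u \<in> C" "v \<in> C" using that by (auto simp: C_def cl_def)
        ultimately show ?thesis by blast
      qed
      finally show ?thesis using False by blast
    qed
  qed
qed

theorem theorem1p1:
  fixes G :: "'a ugraph" and k \<delta> n :: nat
  assumes "k \<ge> 1" and "\<delta> \<ge> 2 * k"
    and "simple_graph G" and "graph_connected G"
    and "graph_order G = n" and "even n" and "int n \<ge> order_bound k \<delta>"
    and "min_degree G = \<delta>"
    and "graph_spectral_radius G \<ge> graph_spectral_radius (extremal_graph k \<delta> n)"
    and "\<not> graph_iso G (extremal_graph k \<delta> n)"
  shows "k_extendable k G"
proof -
  define t where "t = \<delta> - 2 * k"
  have \<delta>: "\<delta> = 2 * k + t" using assms(2) by (simp add: t_def)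
  have card: "card (vertices G) = n" using assms(5) by (simp add: graph_order_def)
  have deg: "\<delta> \<le> card (neighbors G v)" if "v \<in> vertices G" for v
    using min_degree_le_card_neighbors[OF assms(3) that] assms(8) by simp
  have it: "int \<delta> - 2 * int k = int t" using \<delta> by simp
  \<comment> \<open>With \<open>\<delta> = 2 * k + t\<close> the linear bound
    \<open>8 * \<delta> - 10 * k + 4\<close> becomes
    \<open>3 * \<delta> + 5 * t + 4\<close>.\<close>
  have n1: "3 * \<delta> + 5 * t + 4 \<le> n" using assms(7) \<delta> unfolding order_bound_def by linarith
  have "int \<delta> * (int t)\<^sup>2 + int \<delta> - 1 \<le> int n"
    using assms(7) unfolding order_bound_def it by linarith
  then have "int (\<delta> * t\<^sup>2 + \<delta>) \<le> int (n + 1)" by simp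
  then have n2: "\<delta> * t\<^sup>2 + \<delta> \<le> n + 1" by (simp only: of_nat_le_iff)
  define L where "L = real n - real t - 2"
  have L\<delta>: "L \<ge> real \<delta>" using n1 unfolding L_def by linarith
  have \<delta>0: "real \<delta> > 0" using \<delta> assms(1) by simp
  obtain \<epsilon> where \<epsilon>: "\<epsilon> > 0" "\<epsilon> * (L + \<epsilon> + 1) * (L + \<epsilon>) = (real t + 1) * real \<delta> * (real \<delta> + \<epsilon>)"
    using exists_eigenvalue_excess[of "real t" "real \<delta>" L] L\<delta> \<delta>0 by auto
  have "eigenvalue (adjacency_matrix (extremal_graph k \<delta> n)) (L + \<epsilon>)"
    using extremal_graph_eigenvalue[OF \<delta> _ _ L_def \<epsilon>(1) _ \<epsilon>(2)] \<delta>0 L\<delta> \<epsilon>(1) n1 by auto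
  then have \<rho>: "L + \<epsilon> \<le> graph_spectral_radius G"
    using graph_spectral_radius_ge assms(9) order_trans by blast
  have "\<exists>P. perfect_matching G P \<and> M \<subseteq> P" if M: "matching G M" "card M = k" for M
  proof (rule ccontr)
    assume no: "\<not> ?thesis"
    have ev: "even (card (vertices G))" using card assms(6) by simp
    show False
    proof (rule nonextendable_matching_separator[OF assms(3) ev M no])
      fix S and color :: "'a \<Rightarrow> 'a set" and a
      assume S: "S \<subseteq> vertices G" "card S = 2 * k + a" "a + 2 \<le> card (color ` (vertices G - S))"
        "\<And>u v. u \<in> vertices G - S \<Longrightarrow> v \<in> vertices G - S \<Longrightarrow> {u, v} \<in> edges G \<Longrightarrow> color u = color v"
      have "graph_iso G (extremal_graph k \<delta> n)"
        by (rule separator_imp_graph_iso_extremal_graph[OF assms(3,4) card deg assms(1) \<delta> assms(6)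
            n1 n2 L_def \<epsilon> \<rho> S])
      then show False using assms(10) by blast
    qed
  qed
  moreover have "\<exists>M. matching G M \<and> card M = k"
  proof (rule ex_matching_of_card[OF assms(3)])
    show "vertices G \<noteq> {}" using assms(4) by (simp add: graph_connected_def)
    show "2 * k \<le> card (neighbors G v)" if "v \<in> vertices G" for v
      using deg[OF that] assms(2) by simp
  qed
  ultimately show ?thesis using assms(4) unfolding k_extendable_def by blast
qed

end
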